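(* Let $\alpha\in\mathfrak g$ and let $u:\mathbb R\times S^1\to M$ be a smooth twisted harmonic map with respect to the flat connection $A=\alpha\,d\theta$, i.e. $D_A^*D_Au=0$. There is $\varepsilon'_\alpha>0$ depending only on $\alpha$ (and $M$) such that if $$\sup_{t\in\mathbb R}\|D_Au\|_{L^2([t-1,t+1]\times S^1)}\le\varepsilon'_\alpha,$$ then $\partial_{\theta,\alpha}u\equiv0$, i.e. $u$ is a twisted geodesic: for every $\theta$ the curve $t\mapsto u(t,\theta)$ is a geodesic of $M$ and $u$ takes values in the fixed point set $M^\alpha$ of $\exp(2\pi\alpha)$. In particular, if $\alpha$ is non-critical, then $u$ takes values in $M_0$ and each $t\mapsto u(t,\theta)$ is a geodesic in $M_0$.
   Context: $G$ is a compact connected Lie group with Lie algebra $\mathfrak g$ acting isometrically on a compact manifold $M$, $G$-equivariantly embedded in $\mathbb R^K$ with $G$ acting via an orthogonal representation; $\xi\in\mathfrak g$ is viewed as a skew-symmetric matrix acting by $y\mapsto\xi y$. For the flat connection $A=\alpha\,d\theta$ on $\mathbb R\times S^1$, $D_Au=\partial_tu\,dt+\partial_{\theta,\alpha}u\,d\theta$ with $\partial_{\theta,\alpha}u=\partial_\theta u+\alpha u$, and $D_A^*$ is the formal adjoint (flat metric $dt^2+d\theta^2$); $D_A^*D_Au=0$ is equivalent to $(\partial_t^2u+\partial_{\theta,\alpha}^2u)^\top=0$, $\top$ denoting projection onto $TM$. $M_0$ is the set of points of $M$ fixed by all of $G$; $M^\alpha$ is the fixed point set of $\exp(2\pi\alpha)$.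 $\alpha$ is called non-critical if $M^\alpha=M_0$. *)

theory Defs
  imports "HOL-Analysis.Analysis"
begin

definition dderiv :: "'a::real_normed_vector \<Rightarrow> ('a \<Rightarrow> 'b::real_normed_vector) \<Rightarrow> 'a \<Rightarrow> 'b" where
  "dderiv v f x = frechet_derivative f (at x) v"

fun iter_dderiv :: "'a::real_normed_vector list \<Rightarrow> ('a \<Rightarrow> 'b::real_normed_vector) \<Rightarrow> 'a \<Rightarrow> 'b" where
  "iter_dderiv [] f = f"
| "iter_dderiv (v # vs) f = dderiv v (iter_dderiv vs f)"

definition smooth_on :: "'a::real_normed_vector set \<Rightarrow> ('a \<Rightarrow> 'b::real_normed_vector) \<Rightarrow> bool" where
  "smooth_on S f \<longleftrightarrow> (\<forall>vs. iter_dderiv vs f differentiable_on S)"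

definition embedded_submanifold :: "nat \<Rightarrow> (real^'n) set \<Rightarrow> bool" where
  "embedded_submanifold d M \<longleftrightarrow>
     (\<forall>p\<in>M. \<exists>U V (\<phi>::real^'n \<Rightarrow> real^'n) \<psi> E.
        open U \<and> p \<in> U \<and> open V \<and> smooth_on U \<phi> \<and> smooth_on V \<psi> \<and>
        \<phi> ` U = V \<and> (\<forall>x\<in>U. \<psi> (\<phi> x) = x) \<and>
        subspace E \<and> dim E = d \<and> \<phi> ` (M \<inter> U) = E \<inter> V)"

definition tangent_space :: "(real^'n) set \<Rightarrow> real^'n \<Rightarrow> (real^'n) set" where
  "tangent_space S p = {v. \<exists>\<gamma>::real \<Rightarrow> real^'n. smooth_on UNIV \<gamma> \<and> (\<forall>t. \<gamma> t \<in> S) \<and>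
       \<gamma> 0 = p \<and> dderiv 1 \<gamma> 0 = v}"

definition geodesic_in :: "(real^'n) set \<Rightarrow> (real \<Rightarrow> real^'n) \<Rightarrow> bool" where
  "geodesic_in S \<gamma> \<longleftrightarrow> smooth_on UNIV \<gamma> \<and> (\<forall>t. \<gamma> t \<in> S) \<and>
     (\<forall>t. \<forall>v\<in>tangent_space S (\<gamma> t). dderiv 1 (dderiv 1 \<gamma>) t \<bullet> v = 0)"

primrec matpow :: "real^'n^'n \<Rightarrow> nat \<Rightarrow> real^'n^'n" where
  "matpow A 0 = mat 1"
| "matpow A (Suc k) = A ** matpow A k"

definition mexp :: "real^'n^'n \<Rightarrow> real^'n^'n" where
  "mexp A = (\<Sum>k. inverse (fact k) *\<^sub>R matpow A k)"

definition compact_connected_orthogonal_group :: "(real^'n^'n) set \<Rightarrow> bool" where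
  "compact_connected_orthogonal_group G \<longleftrightarrow>
     compact G \<and> connected G \<and> (\<forall>g\<in>G. orthogonal_matrix g) \<and> mat 1 \<in> G \<and>
     (\<forall>g\<in>G. \<forall>h\<in>G. g ** h \<in> G) \<and> (\<forall>g\<in>G. matrix_inv g \<in> G)"

definition lie_algebra :: "(real^'n^'n) set \<Rightarrow> (real^'n^'n) set" where
  "lie_algebra G = {\<xi>. \<forall>s::real. mexp (s *\<^sub>R \<xi>) \<in> G}"

definition fixed_by_group :: "(real^'n^'n) set \<Rightarrow> (real^'n) set \<Rightarrow> (real^'n) set" where
  "fixed_by_group G M = {p\<in>M. \<forall>g\<in>G. g *v p = p}"

definition fixed_alpha :: "real^'n^'n \<Rightarrow> (real^'n) set \<Rightarrow> (real^'n) set" where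
  "fixed_alpha \<alpha> M = {p\<in>M. mexp ((2 * pi) *\<^sub>R \<alpha>) *v p = p}"

text \<open>Derivatives on the cylinder R x S^1 (coordinates (t,theta), theta 2pi-periodic).\<close>

definition d_t :: "(real \<times> real \<Rightarrow> real^'n) \<Rightarrow> real \<times> real \<Rightarrow> real^'n" where
  "d_t f = dderiv (1, 0) f"

definition d_theta_alpha :: "real^'n^'n \<Rightarrow> (real \<times> real \<Rightarrow> real^'n) \<Rightarrow> real \<times> real \<Rightarrow> real^'n" where
  "d_theta_alpha \<alpha> f = (\<lambda>z. dderiv (0, 1) f z + \<alpha> *v f z)"

definition twisted_harmonic :: "(real^'n) set \<Rightarrow> real^'n^'n \<Rightarrow> (real \<times> real \<Rightarrow> real^'n) \<Rightarrow> bool" where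
  "twisted_harmonic M \<alpha> u \<longleftrightarrow>
     (\<forall>z. \<forall>v\<in>tangent_space M (u z).
        (d_t (d_t u) z + d_theta_alpha \<alpha> (d_theta_alpha \<alpha> u) z) \<bullet> v = 0)"

definition local_L2_DA :: "real^'n^'n \<Rightarrow> (real \<times> real \<Rightarrow> real^'n) \<Rightarrow> real \<Rightarrow> real" where
  "local_L2_DA \<alpha> u t = sqrt (integral (cbox (t - 1, 0) (t + 1, 2 * pi))
      (\<lambda>z. (norm (d_t u z))\<^sup>2 + (norm (d_theta_alpha \<alpha> u z))\<^sup>2))"

end

theory Submission
  imports Defs
begin

text \<open>
  Write \<open>D = \<partial>\<^sub>\<theta> + \<alpha>\<close> and \<open>\<tau> = \<partial>\<^sub>t\<^sup>2 u + D\<^sup>2 u\<close>. Since \<open>\<alpha>\<close> is skew, \<open>D\<close> obeys the Leibniz rule for inner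
  products, and the curves \<open>s \<mapsto> u (t + s, \<theta>)\<close> and \<open>s \<mapsto> exp (s \<alpha>) u (t, \<theta> + s)\<close> in \<open>M\<close> show that
  \<open>\<partial>\<^sub>t u\<close> and \<open>D u\<close> are tangent, hence orthogonal to \<open>\<tau>\<close>. Compactness of \<open>M\<close> gives
  \<open>\<langle>q - p, n\<rangle> \<le> C |q - p|\<^sup>2 |n|\<close> for normal vectors \<open>n\<close> at \<open>p\<close>; applied to the two curves this yields
  \<open>|\<tau>| \<le> 2 C e\<close> with \<open>e = |\<partial>\<^sub>t u|\<^sup>2 + |D u|\<^sup>2\<close>. Differentiating \<open>\<langle>\<partial>\<^sub>t u, \<tau>\<rangle> = \<langle>D u, \<tau>\<rangle> = 0\<close> turns the
  Bochner formula into \<open>\<Delta> e \<ge> - 2 |\<tau>|\<^sup>2 \<ge> - 8 C\<^sup>2 e\<^sup>2\<close>, so by Heinz' argument and the mean value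
  inequality small local energy makes \<open>e\<close> uniformly small.

  For \<open>f t = \<integral> |D u|\<^sup>2 d\<theta>\<close> one gets \<open>f'' \<ge> 2 \<integral> |D\<^sup>2 u|\<^sup>2 d\<theta> - (small) f\<close>. As \<open>D\<close> is skew-adjoint,
  \<open>D u\<close> is orthogonal to its kernel and a Poincare inequality with a constant depending only on \<open>\<alpha>\<close>
  gives \<open>f'' \<ge> c f\<close> with \<open>c > 0\<close>. A bounded function on the line with this property vanishes.
\<close>

section \<open>Directional derivatives and smoothness\<close>

text \<open>The hypothesis is only an L2 bound on windows, while the error in the equation for f is
  of size |\<tau>| |D u|^2 and \<tau> is itself quadratic in the first derivatives. A pointwise
  bound on the energy density is needed to absorb this error, hence the detour through Heinz'
  argument. No curvature tensor of M occurs: the quadratic inequality for normal vectors stands for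
  a bound on the second fundamental form, and differentiating the orthogonality relations of \<tau>
  replaces the curvature terms of the Bochner formula. The obstacle in the Poincare step is that
  exp(2 pi \<alpha>) may have eigenvalue 1, so that D has a kernel on periodic functions. The
  inequality survives because D u is D applied to a periodic function, namely u itself regarded as
  vector valued. Smoothness is given by iterated directional derivatives and tangent vectors by
  curves on the whole line; smoothness of the required curves is obtained by exhibiting families
  closed under differentiation.\<close>

lemma iter_dderiv_append: "iter_dderiv (vs @ ws) f = iter_dderiv vs (iter_dderiv ws f)"
  by (induction vs) auto

lemma smooth_on_dderiv: "smooth_on S f \<Longrightarrow> smooth_on S (dderiv v f)"
  unfolding smooth_on_def
  using iter_dderiv_append[of _ "[v]" f] by (metis iter_dderiv.simps)

lemma smooth_on_iter_dderiv: "smooth_on S f \<Longrightarrow> smooth_on S (iter_dderiv vs f)"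
  unfolding smooth_on_def by (metis iter_dderiv_append)

lemma smooth_on_differentiable_at:
  assumes "smooth_on S f" "open S" "x \<in> S"
  shows "f differentiable (at x)"
  using assms iter_dderiv.simps(1)[of f] unfolding smooth_on_def differentiable_on_def
  by (metis at_within_open)

lemma has_derivative_dderiv:
  assumes "f differentiable (at x)"
  shows "(f has_derivative (\<lambda>v. dderiv v f x)) (at x)"
  using assms frechet_derivative_works unfolding dderiv_def by fastforce

lemma dderiv_eq: "(f has_derivative f') (at x) \<Longrightarrow> dderiv v f x = f' v"
  unfolding dderiv_def by (metis frechet_derivative_at)

lemma dderiv_eq_on_open:
  assumes "open S" "x \<in> S" "\<And>y. y \<in> S \<Longrightarrow> f y = g y" "g differentiable (at x)"
  shows "dderiv v f x = dderiv v g x"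
proof (rule dderiv_eq)
  show "(f has_derivative (\<lambda>v. dderiv v g x)) (at x)"
    using has_derivative_transform_within_open[OF has_derivative_dderiv[OF assms(4)] assms(1,2)] assms(3)
    by simp
qed

text \<open>Off S nothing is known about \<open>dderiv\<close>, so closure of the family is asked up
  to equality on the open set S. Induction on the list of directions identifies each iterated
  derivative on S with a member of F, and these are differentiable there.\<close>

lemma smooth_on_coinduct:
  assumes S: "open S" and f: "f \<in> F"
    and diff: "\<And>f x. f \<in> F \<Longrightarrow> x \<in> S \<Longrightarrow> f differentiable (at x)"
    and closed: "\<And>f v. f \<in> F \<Longrightarrow> \<exists>g\<in>F. \<forall>x\<in>S. dderiv v f x = g x"
  shows "smooth_on S f"
proof -
  have "\<exists>g\<in>F. \<forall>x\<in>S. iter_dderiv vs f x = g x" for vs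
  proof (induction vs)
    case (Cons v vs)
    then obtain g where g: "g \<in> F" "\<forall>x\<in>S. iter_dderiv vs f x = g x" by blast
    then have "\<forall>x\<in>S. dderiv v (iter_dderiv vs f) x = dderiv v g x"
      using dderiv_eq_on_open[OF S] diff by blast
    then show ?case using closed[OF g(1), of v] by auto
  qed (use f in auto)
  moreover have "iter_dderiv vs f differentiable (at x)"
    if "g \<in> F" "\<forall>x\<in>S. iter_dderiv vs f x = g x" "x \<in> S" for vs g x
    using has_derivative_transform_within_open[OF has_derivative_dderiv[OF diff[OF that(1,3)]] S that(3)] that(2)
    unfolding differentiable_def by (metis (no_types))
  ultimately show ?thesis
    unfolding smooth_on_def differentiable_on_def
    by (metis differentiable_at_withinI)
qed

lemma dderiv_vector_derivative:
  assumes "(f has_vector_derivative f') (at x)"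
  shows "dderiv v f x = v *\<^sub>R f'"
  using assms dderiv_eq unfolding has_vector_derivative_def by blast

text \<open>On the line a derivative in direction \<open>v\<close> is \<open>v\<close> times the
  ordinary one. Scalar multiples are adjoined to F inside the proof, so F itself has to be closed
  under ordinary differentiation alone.\<close>

lemma smooth_curveI:
  fixes F :: "(real \<Rightarrow> 'a::real_normed_vector) set"
  assumes f: "f \<in> F"
    and closed: "\<And>f. f \<in> F \<Longrightarrow> \<exists>g\<in>F. \<forall>s. (f has_vector_derivative g s) (at s)"
  shows "smooth_on UNIV f"
proof (rule smooth_on_coinduct[where F = "{\<lambda>s. c *\<^sub>R f s | c f. f \<in> F}"])
  show "f \<in> {\<lambda>s. c *\<^sub>R f s |c f. f \<in> F}"
    using f by (auto intro!: exI[of _ 1] exI[of _ f])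
  have *: "\<exists>g\<in>F. \<forall>s. ((\<lambda>s. c *\<^sub>R f s) has_vector_derivative c *\<^sub>R g s) (at s)" if "f \<in> F" for c f
    using closed[OF that] by (auto intro!: derivative_eq_intros)
  show "f differentiable at x" if fi: "f \<in> {\<lambda>s. c *\<^sub>R f s |c f. f \<in> F}" for f x
  proof -
    obtain c h where h: "f = (\<lambda>s. c *\<^sub>R h s)" "h \<in> F" using fi by fast
    then obtain g where "\<forall>s. ((\<lambda>s. c *\<^sub>R h s) has_vector_derivative c *\<^sub>R g s) (at s)" using * by blast
    then show ?thesis using h unfolding has_vector_derivative_def differentiable_def by blast
  qed
  show "\<exists>g\<in>{\<lambda>s. c *\<^sub>R f s |c f. f \<in> F}. \<forall>x\<in>UNIV. dderiv v f x = g x"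
    if fi: "f \<in> {\<lambda>s. c *\<^sub>R f s |c f. f \<in> F}" for f v
  proof -
    obtain c h where h: "f = (\<lambda>s. c *\<^sub>R h s)" "h \<in> F" using fi by fast
    obtain g where g: "g \<in> F" "\<forall>s. ((\<lambda>s. c *\<^sub>R h s) has_vector_derivative c *\<^sub>R g s) (at s)"
      using *[OF h(2)] by blast
    then have "dderiv v f x = (v * c) *\<^sub>R g x" for x
      using h dderiv_vector_derivative by fastforce
    then show ?thesis using g(1) by (intro bexI[of _ "\<lambda>x. (v * c) *\<^sub>R g x"]) auto
  qed
qed auto

lemma smooth_on_add_matrix:
  fixes f g :: "'a::real_normed_vector \<Rightarrow> real^'n"
  assumes "smooth_on UNIV f" "smooth_on UNIV g"
  shows "smooth_on UNIV (\<lambda>z. f z + A *v g z)"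
proof (rule smooth_on_coinduct[where F = "{\<lambda>z. f z + A *v g z | f g. smooth_on UNIV f \<and> smooth_on UNIV g}"])
  have *: "((\<lambda>z. f z + A *v g z) has_derivative (\<lambda>v. dderiv v f x + A *v dderiv v g x)) (at x)"
    if "smooth_on UNIV f" "smooth_on UNIV g" for f g :: "'a \<Rightarrow> real^'n" and x
    by (intro has_derivative_add bounded_linear.has_derivative[OF matrix_vector_mul_bounded_linear]
        has_derivative_dderiv smooth_on_differentiable_at[OF that(1)] smooth_on_differentiable_at[OF that(2)]) auto
  show "f differentiable at x"
    if fi: "f \<in> {\<lambda>z. f z + A *v g z | f g. smooth_on UNIV f \<and> smooth_on UNIV g}" for f :: "'a \<Rightarrow> real^'n" and x
  proof -
    obtain a b where ab: "f = (\<lambda>z. a z + A *v b z)" "smooth_on UNIV a" "smooth_on UNIV b"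
      using fi by fast
    show ?thesis using *[OF ab(2,3)] unfolding ab(1) differentiable_def by blast
  qed
  show "\<exists>g\<in>{\<lambda>z. f z + A *v g z | f g. smooth_on UNIV f \<and> smooth_on UNIV g}.
      \<forall>x\<in>UNIV. dderiv v f x = g x"
    if fi: "f \<in> {\<lambda>z. f z + A *v g z | f g. smooth_on UNIV f \<and> smooth_on UNIV g}" for f :: "'a \<Rightarrow> real^'n" and v
  proof -
    obtain a b where ab: "f = (\<lambda>z. a z + A *v b z)" "smooth_on UNIV a" "smooth_on UNIV b"
      using fi by fast
    have "dderiv v f x = dderiv v a x + A *v dderiv v b x" for x
      unfolding ab(1) by (rule dderiv_eq[OF *[OF ab(2,3)]])
    then show ?thesis
      using smooth_on_dderiv[OF ab(2), of v] smooth_on_dderiv[OF ab(3), of v]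
      by (intro bexI[of _ "\<lambda>x. dderiv v a x + A *v dderiv v b x"]) fast+
  qed
  show "(\<lambda>z. f z + A *v g z) \<in> {\<lambda>z. f z + A *v g z | f g. smooth_on UNIV f \<and> smooth_on UNIV g}"
    using assms by fast
qed auto

lemma smooth_d_t: "smooth_on UNIV f \<Longrightarrow> smooth_on UNIV (d_t f)"
  unfolding d_t_def by (rule smooth_on_dderiv)

lemma smooth_d_theta_alpha: "smooth_on UNIV f \<Longrightarrow> smooth_on UNIV (d_theta_alpha \<alpha> f)"
  unfolding d_theta_alpha_def by (intro smooth_on_add_matrix smooth_on_dderiv)

lemma smooth_on_continuous: "smooth_on UNIV f \<Longrightarrow> continuous_on UNIV f"
  by (meson UNIV_I continuous_at_imp_continuous_on differentiable_imp_continuous_within open_UNIV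
      smooth_on_differentiable_at)

lemma smooth_has_derivative:
  fixes f :: "real \<times> real \<Rightarrow> 'b::real_normed_vector"
  assumes "smooth_on UNIV f"
  shows "(f has_derivative (\<lambda>h. fst h *\<^sub>R dderiv (1,0) f z + snd h *\<^sub>R dderiv (0,1) f z)) (at z)"
proof -
  have d: "(f has_derivative (\<lambda>v. dderiv v f z)) (at z)"
    using assms smooth_on_differentiable_at has_derivative_dderiv by blast
  then interpret bounded_linear "\<lambda>v. dderiv v f z" by (rule has_derivative_bounded_linear)
  have "dderiv h f z = fst h *\<^sub>R dderiv (1,0) f z + snd h *\<^sub>R dderiv (0,1) f z" for h
  proof -
    have "dderiv h f z = dderiv (fst h *\<^sub>R (1,0) + snd h *\<^sub>R (0,1)) f z"
      by simp
    also have "\<dots> = fst h *\<^sub>R dderiv (1,0) f z + snd h *\<^sub>R dderiv (0,1) f z"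
      by (simp only: add scaleR)
    finally show ?thesis .
  qed
  then have "(\<lambda>h. dderiv h f z) = (\<lambda>h. fst h *\<^sub>R dderiv (1,0) f z + snd h *\<^sub>R dderiv (0,1) f z)"
    by (rule ext)
  with d show ?thesis by (rule subst[rotated])
qed

lemma has_vector_derivative_fst:
  fixes f :: "real \<times> real \<Rightarrow> 'b::real_normed_vector"
  assumes "(f has_derivative (\<lambda>h. fst h *\<^sub>R a + snd h *\<^sub>R b)) (at (t, \<theta>))"
  shows "((\<lambda>t. f (t, \<theta>)) has_vector_derivative a) (at t within S)"
proof -
  have "((\<lambda>t. (t, \<theta>)) has_derivative (\<lambda>h. (h, 0))) (at t within S)"
    by (auto intro!: derivative_eq_intros)
  from diff_chain_within[OF this has_derivative_at_withinI[OF assms]]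
  show ?thesis unfolding has_vector_derivative_def by (simp add: o_def)
qed

lemma has_vector_derivative_snd:
  fixes f :: "real \<times> real \<Rightarrow> 'b::real_normed_vector"
  assumes "(f has_derivative (\<lambda>h. fst h *\<^sub>R a + snd h *\<^sub>R b)) (at (t, \<theta>))"
  shows "((\<lambda>\<theta>. f (t, \<theta>)) has_vector_derivative b) (at \<theta> within S)"
proof -
  have "((\<lambda>\<theta>. (t, \<theta>)) has_derivative (\<lambda>h. (0, h))) (at \<theta> within S)"
    by (auto intro!: derivative_eq_intros)
  from diff_chain_within[OF this has_derivative_at_withinI[OF assms]]
  show ?thesis unfolding has_vector_derivative_def by (simp add: o_def)
qed

lemma smooth_slice_t:
  fixes f :: "real \<times> real \<Rightarrow> 'b::real_normed_vector"
  shows "smooth_on UNIV f \<Longrightarrow> ((\<lambda>t. f (t, \<theta>)) has_vector_derivative dderiv (1,0) f (t, \<theta>)) (at t within S)"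
  by (erule has_vector_derivative_fst[OF smooth_has_derivative])

lemma smooth_slice_theta:
  fixes f :: "real \<times> real \<Rightarrow> 'b::real_normed_vector"
  shows "smooth_on UNIV f \<Longrightarrow> ((\<lambda>\<theta>. f (t, \<theta>)) has_vector_derivative dderiv (0,1) f (t, \<theta>)) (at \<theta> within S)"
  by (erule has_vector_derivative_snd[OF smooth_has_derivative])

text \<open>Schwarz' theorem by integration: f is its value at (t, a) plus the integral of its
  \<theta>-derivative. Differentiate in t under the integral sign, then in the upper limit.\<close>

lemma mixed_partials_commute:
  fixes f :: "real \<times> real \<Rightarrow> 'b::euclidean_space"
  assumes f: "smooth_on UNIV f"
  shows "dderiv (1,0) (dderiv (0,1) f) z = dderiv (0,1) (dderiv (1,0) f) z"
proof -
  obtain t \<theta> where z: "z = (t, \<theta>)" by fastforce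
  define g where "g = dderiv (1,0) (dderiv (0,1) f)"
  have sm: "smooth_on UNIV (dderiv (0,1) f)" "smooth_on UNIV (dderiv (1,0) f)" "smooth_on UNIV g"
    unfolding g_def using f by (auto intro!: smooth_on_dderiv)
  \<comment> \<open>A base point strictly below \<theta> makes \<theta> interior to the interval of
    integration, so the derivative within it becomes a two-sided one.\<close>
  define a where "a = \<theta> - 1"
  have cont: "continuous_on A (\<lambda>s. h (c, s))" if "smooth_on UNIV h" for h :: "real\<times>real \<Rightarrow> 'b" and c A
    by (rule continuous_on_compose2[OF smooth_on_continuous[OF that]]) (auto intro!: continuous_intros)
  have I1: "f (t', \<theta>') = f (t', a) + integral (cbox a \<theta>') (\<lambda>s. dderiv (0,1) f (t', s))" if "\<theta>' \<ge> a" for t' \<theta>'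
  proof -
    have "((\<lambda>s. dderiv (0,1) f (t', s)) has_integral f (t', \<theta>') - f (t', a)) {a..\<theta>'}"
      by (rule fundamental_theorem_of_calculus[OF that]) (rule smooth_slice_theta[OF f])
    then show ?thesis by (auto simp: integral_unique)
  qed
  have I2: "dderiv (1,0) f (t, \<theta>') = dderiv (1,0) f (t, a) + integral (cbox a \<theta>') (\<lambda>s. g (t, s))"
    if "\<theta>' \<ge> a" for \<theta>'
  proof -
    have "((\<lambda>t. integral (cbox a \<theta>') (\<lambda>s. dderiv (0,1) f (t, s))) has_vector_derivative
       integral (cbox a \<theta>') (\<lambda>s. g (t, s))) (at t within UNIV)"
    proof (rule leibniz_rule_vector_derivative)
      show "((\<lambda>x. dderiv (0,1) f (x, s)) has_vector_derivative g (x, s)) (at x within UNIV)" for x s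
        unfolding g_def by (rule smooth_slice_t[OF sm(1)])
      show "(\<lambda>s. dderiv (0, 1) f (x, s)) integrable_on cbox a \<theta>'" for x
        by (rule integrable_continuous) (rule cont[OF sm(1)])
      show "continuous_on (UNIV \<times> cbox a \<theta>') (\<lambda>(x, t). g (x, t))"
        using continuous_on_subset[OF smooth_on_continuous[OF sm(3)], of "UNIV \<times> cbox a \<theta>'"] by simp
    qed auto
    then have "((\<lambda>t. f (t, a) + integral (cbox a \<theta>') (\<lambda>s. dderiv (0,1) f (t, s))) has_vector_derivative
       dderiv (1,0) f (t, a) + integral (cbox a \<theta>') (\<lambda>s. g (t, s))) (at t)"
      by (intro has_vector_derivative_add smooth_slice_t[OF f]) auto
    moreover have "(\<lambda>t. f (t, a) + integral (cbox a \<theta>') (\<lambda>s. dderiv (0,1) f (t, s))) = (\<lambda>t. f (t, \<theta>'))"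
      using I1[OF that] by simp
    ultimately show ?thesis
      using smooth_slice_t[OF f, where S=UNIV] by (metis vector_derivative_unique_at)
  qed
  have "((\<lambda>\<theta>. integral {a..\<theta>} (\<lambda>s. g (t, s))) has_vector_derivative g (t, \<theta>)) (at \<theta> within {a..\<theta>+1})"
    by (rule integral_has_vector_derivative) (auto intro: cont[OF sm(3)] simp: a_def)
  then have "((\<lambda>\<theta>. dderiv (1,0) f (t, a) + integral {a..\<theta>} (\<lambda>s. g (t, s))) has_vector_derivative g (t, \<theta>)) (at \<theta> within {a<..<\<theta>+1})"
    by (auto intro!: derivative_eq_intros intro: has_vector_derivative_within_subset)
  then have "((\<lambda>\<theta>. dderiv (1,0) f (t, a) + integral {a..\<theta>} (\<lambda>s. g (t, s))) has_vector_derivative g (t, \<theta>)) (at \<theta>)"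
    by (subst (asm) at_within_open) (auto simp: a_def)
  then have "((\<lambda>\<theta>. dderiv (1,0) f (t, \<theta>)) has_vector_derivative g (t, \<theta>)) (at \<theta>)"
  proof (rule has_vector_derivative_transform_within_open[of _ _ _ "{a<..}"])
    show "dderiv (1,0) f (t, a) + integral {a..y} (\<lambda>s. g (t, s)) = dderiv (1,0) f (t, y)" if "y \<in> {a<..}" for y
      using I2[of y] that by simp
  qed (auto simp: a_def)
  then show ?thesis
    unfolding z using smooth_slice_theta[OF sm(2), where S=UNIV] by (metis g_def vector_derivative_unique_at)
qed

section \<open>The matrix exponential and a twisted Poincare inequality\<close>

lemma has_vector_derivative_cart:
  fixes f :: "real \<Rightarrow> real^'n"
  shows "(f has_vector_derivative f') (at x within S) \<longleftrightarrow>
     (\<forall>i. ((\<lambda>x. f x $ i) has_vector_derivative f' $ i) (at x within S))"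
  unfolding has_vector_derivative_def
  by (subst has_derivative_componentwise_within) (simp add: Basis_vec_def inner_axis)

section \<open>The matrix exponential as an entrywise power series\<close>

lemma matpow_scaleR: "matpow (s *\<^sub>R A) k = s ^ k *\<^sub>R matpow A k"
  by (induction k) (simp_all add: vec_eq_iff matrix_matrix_mult_def sum_distrib_left mult_ac)

lemma matpow_commute: "matpow A k ** A = A ** matpow A k"
  by (induction k) (auto simp: matrix_mul_assoc[symmetric])

text \<open>The sum b of the absolute values of all entries dominates every row sum. The resulting
  geometric growth makes each entry of the exponential series comparable with a scalar
  exponential.\<close>

lemma matpow_entry_bound:
  fixes A :: "real^'n^'n"
  obtains B where "\<And>k i j. \<bar>matpow A k $ i $ j\<bar> \<le> B ^ k"
proof -
  define b where "b = (\<Sum>i\<in>UNIV. \<Sum>j\<in>UNIV. \<bar>A $ i $ j\<bar>)"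
  have b0: "b \<ge> 0" unfolding b_def by (intro sum_nonneg) auto
  have "\<bar>matpow A k $ i $ j\<bar> \<le> b ^ k" for k i j
  proof (induction k arbitrary: i j)
    case 0
    then show ?case by (simp add: mat_def)
  next
    case (Suc k)
    have "\<bar>matpow A (Suc k) $ i $ j\<bar> \<le> (\<Sum>l\<in>UNIV. \<bar>A $ i $ l\<bar> * \<bar>matpow A k $ l $ j\<bar>)"
      unfolding matpow.simps matrix_matrix_mult_def by (simp add: abs_mult[symmetric] sum_abs)
    also have "\<dots> \<le> (\<Sum>l\<in>UNIV. \<bar>A $ i $ l\<bar> * b ^ k)"
      by (intro sum_mono mult_left_mono Suc) auto
    also have "\<dots> = (\<Sum>l\<in>UNIV. \<bar>A $ i $ l\<bar>) * b ^ k" by (simp add: sum_distrib_right)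
    also have "(\<Sum>l\<in>UNIV. \<bar>A $ i $ l\<bar>) \<le> b"
      unfolding b_def by (rule member_le_sum) (auto intro: sum_nonneg)
    finally show ?case using b0 by (simp add: mult_right_mono)
  qed
  then show thesis using that by blast
qed

lemma summable_mexp_entry:
  fixes A :: "real^'n^'n"
  shows "summable (\<lambda>k. matpow A k $ i $ j / fact k * s ^ k)"
proof -
  obtain B where B: "\<And>k i j. \<bar>matpow A k $ i $ j\<bar> \<le> B ^ k" using matpow_entry_bound by blast
  show ?thesis
  proof (rule summable_comparison_test'[OF summable_exp[of "B * \<bar>s\<bar>"], of 0])
    fix k :: nat
    have "norm (matpow A k $ i $ j / fact k * s ^ k) = inverse (fact k) * (\<bar>matpow A k $ i $ j\<bar> * \<bar>s\<bar> ^ k)"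
      by (simp add: abs_mult power_abs divide_simps)
    also have "\<dots> \<le> inverse (fact k) * (B ^ k * \<bar>s\<bar> ^ k)"
      by (intro mult_left_mono mult_right_mono B) auto
    finally show "norm (matpow A k $ i $ j / fact k * s ^ k) \<le> inverse (fact k) * (B * \<bar>s\<bar>) ^ k"
      by (simp add: power_mult_distrib)
  qed
qed

lemma mexp_entry:
  fixes A :: "real^'n^'n"
  shows "mexp (s *\<^sub>R A) $ i $ j = (\<Sum>k. matpow A k $ i $ j / fact k * s ^ k)"
proof -
  define c where "c i j k = matpow A k $ i $ j / fact k * s ^ k" for i j k
  have "(\<lambda>k. inverse (fact k) *\<^sub>R matpow (s *\<^sub>R A) k) sums (\<chi> i j. \<Sum>k. c i j k)"
    unfolding sums_def
  proof (intro vec_tendstoI)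
    fix i j
    have "(\<lambda>n. \<Sum>k<n. c i j k) \<longlonglongrightarrow> (\<Sum>k. c i j k)"
      using summable_mexp_entry[of A i j s] unfolding c_def by (rule summable_LIMSEQ)
    moreover have "(\<Sum>k<n. inverse (fact k) *\<^sub>R matpow (s *\<^sub>R A) k) $ i $ j = (\<Sum>k<n. c i j k)" for n
      by (simp add: c_def matpow_scaleR divide_inverse mult_ac)
    ultimately show "(\<lambda>n. (\<Sum>k<n. inverse (fact k) *\<^sub>R matpow (s *\<^sub>R A) k) $ i $ j)
        \<longlonglongrightarrow> (\<chi> i j. \<Sum>k. c i j k) $ i $ j"
      by simp
  qed
  then show ?thesis unfolding mexp_def c_def by (simp add: sums_iff)
qed

text \<open>Termwise differentiation: the k-th coefficient of the derived series is an entry of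
  A^(k+1) / k!. The power is rewritten with its extra factor A on the right, the side on which a
  vector is applied later.\<close>

lemma mexp_entry_deriv:
  fixes A :: "real^'n^'n"
  shows "((\<lambda>s. mexp (s *\<^sub>R A) $ i $ j) has_real_derivative (mexp (s *\<^sub>R A) ** A) $ i $ j) (at s)"
proof -
  define c where "c k = matpow A k $ i $ j / fact k" for k
  have "((\<lambda>s. \<Sum>k. c k * s ^ k) has_real_derivative (\<Sum>k. diffs c k * s ^ k)) (at s)"
    by (rule termdiffs_strong_converges_everywhere) (unfold c_def, rule summable_mexp_entry)
  moreover have "diffs c k * s ^ k = (\<Sum>l\<in>UNIV. (matpow A k $ i $ l / fact k * s ^ k) * A $ l $ j)" for k
  proof -
    have "diffs c k = (A ** matpow A k) $ i $ j / fact k"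
      unfolding diffs_def c_def by (simp add: divide_simps del: of_nat_Suc)
    also have "\<dots> = (\<Sum>l\<in>UNIV. matpow A k $ i $ l * A $ l $ j) / fact k"
      by (simp add: matpow_commute[symmetric]) (simp add: matrix_matrix_mult_def)
    finally show ?thesis
      by (simp add: sum_divide_distrib sum_distrib_left sum_distrib_right mult_ac)
  qed
  moreover have "(\<Sum>k. \<Sum>l\<in>UNIV. (matpow A k $ i $ l / fact k * s ^ k) * A $ l $ j) =
      (\<Sum>l\<in>UNIV. (\<Sum>k. matpow A k $ i $ l / fact k * s ^ k) * A $ l $ j)"
    by (simp only: suminf_sum[OF summable_mult2[OF summable_mexp_entry]] suminf_mult2[OF summable_mexp_entry])
  ultimately show ?thesis
    by (simp add: mexp_entry c_def matrix_matrix_mult_def[of _ A])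
qed

lemma mexp_0: "mexp (0::real^'n^'n) = mat 1"
proof -
  have "mexp (0 *\<^sub>R (0::real^'n^'n)) $ i $ j = mat 1 $ i $ j" for i j
    using powser_zero[of "\<lambda>k. matpow (0::real^'n^'n) k $ i $ j / fact k"] unfolding mexp_entry by simp
  then show ?thesis by (simp add: vec_eq_iff)
qed

text \<open>Multiplication by exp(s A) conjugates d/ds + A into d/ds. The Poincare inequality, the
  tangency of D u and the passage to the fixed point set rest on this.\<close>

lemma mexp_apply_deriv:
  fixes A :: "real^'n^'n"
  assumes "(f has_vector_derivative f') (at s within S)"
  shows "((\<lambda>s. mexp (s *\<^sub>R A) *v f s) has_vector_derivative mexp (s *\<^sub>R A) *v (A *v f s + f')) (at s within S)"
proof -
  have f: "((\<lambda>x. f x $ i) has_real_derivative f' $ i) (at s within S)" for i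
    using assms unfolding has_vector_derivative_cart has_real_derivative_iff_has_vector_derivative by blast
  have "((\<lambda>s. \<Sum>j\<in>UNIV. mexp (s *\<^sub>R A) $ i $ j * f s $ j) has_real_derivative
      (\<Sum>j\<in>UNIV. (mexp (s *\<^sub>R A) ** A) $ i $ j * f s $ j + f' $ j * mexp (s *\<^sub>R A) $ i $ j)) (at s within S)" for i
    by (intro DERIV_sum DERIV_mult f has_field_derivative_at_within[OF mexp_entry_deriv])
  moreover have "(\<Sum>j\<in>UNIV. (mexp (s *\<^sub>R A) ** A) $ i $ j * f s $ j + f' $ j * mexp (s *\<^sub>R A) $ i $ j)
      = (mexp (s *\<^sub>R A) *v (A *v f s + f')) $ i" for i
    by (simp add: matrix_vector_right_distrib matrix_vector_mul_assoc)
      (simp add: matrix_vector_mult_def sum.distrib mult.commute)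
  ultimately show ?thesis
    unfolding has_vector_derivative_cart has_real_derivative_iff_has_vector_derivative[symmetric]
    by (simp add: matrix_vector_mult_def[of "mexp _"])
qed

lemma orthogonal_matrix_inner:
  fixes Q :: "real^'n^'n"
  assumes "orthogonal_matrix Q"
  shows "(Q *v x) \<bullet> (Q *v y) = x \<bullet> y"
proof -
  have "(Q *v x) \<bullet> (Q *v y) = x \<bullet> (transpose Q *v (Q *v y))"
    by (metis dot_lmul_matrix inner_commute transpose_matrix_vector)
  also have "\<dots> = x \<bullet> y"
    using assms by (simp add: matrix_vector_mul_assoc orthogonal_matrix_def)
  finally show ?thesis .
qed

text \<open>Differentiate the constant inner product of exp(s A) x and exp(s A) y at s = 0.\<close>

lemma orthogonal_mexp_skew:
  fixes A :: "real^'n^'n"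
  assumes "\<And>s. orthogonal_matrix (mexp (s *\<^sub>R A))"
  shows "(A *v x) \<bullet> y = - (x \<bullet> (A *v y))"
proof -
  have "((\<lambda>s. mexp (s *\<^sub>R A) *v z) has_vector_derivative A *v z) (at 0)" for z
    using mexp_apply_deriv[OF has_vector_derivative_const[of z], of A 0 UNIV] by (simp add: mexp_0)
  from bounded_bilinear.has_vector_derivative[OF bounded_bilinear_inner this[of x] this[of y]]
  have "((\<lambda>s. x \<bullet> y) has_vector_derivative (x \<bullet> (A *v y) + (A *v x) \<bullet> y)) (at (0::real))"
    by (simp add: orthogonal_matrix_inner[OF assms] mexp_0)
  moreover have "((\<lambda>s. x \<bullet> y) has_vector_derivative 0) (at (0::real))" by simp
  ultimately show ?thesis using vector_derivative_unique_at by fastforce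
qed

section \<open>A Poincare inequality for d/d\<theta> + A on the circle\<close>

lemma continuous_on_mexp_apply:
  fixes A :: "real^'n^'n"
  shows "continuous_on S f \<Longrightarrow> continuous_on S (\<lambda>s. mexp (s *\<^sub>R A) *v f s)"
proof -
  assume f: "continuous_on S f"
  have c: "continuous_on S (\<lambda>s. mexp (s *\<^sub>R A) $ i $ j)" for i j
    by (intro continuous_at_imp_continuous_on ballI DERIV_continuous[OF mexp_entry_deriv])
  show ?thesis
    unfolding matrix_vector_mult_def 
    by (intro continuous_on_vec_lambda continuous_on_sum continuous_on_mult[OF c continuous_on_component[OF f]])
qed

text \<open>Integrate the square of f - m, where m is the mean of f.\<close>

lemma cauchy_schwarz_integral:
  fixes f :: "real \<Rightarrow> real"
  assumes f: "continuous_on {a..b} f" and ab: "a < b"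
  shows "(integral {a..b} f)\<^sup>2 \<le> (b - a) * integral {a..b} (\<lambda>x. (f x)\<^sup>2)"
proof -
  define m where "m = integral {a..b} f / (b - a)"
  have i: "f integrable_on {a..b}" "(\<lambda>x. (f x)\<^sup>2) integrable_on {a..b}"
    using f by (auto intro!: integrable_continuous_interval continuous_intros)
  have "((\<lambda>x. (f x)\<^sup>2 - 2 * m * f x + m\<^sup>2) has_integral
      integral {a..b} (\<lambda>x. (f x)\<^sup>2) - 2 * m * integral {a..b} f + (b - a) * m\<^sup>2) {a..b}"
    using ab has_integral_const_real[of "m\<^sup>2" a b]
    by (intro has_integral_add has_integral_diff has_integral_mult_right integrable_integral i) auto
  then have "0 \<le> integral {a..b} (\<lambda>x. (f x)\<^sup>2) - 2 * m * integral {a..b} f + (b - a) * m\<^sup>2"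
  proof (rule has_integral_nonneg)
    show "0 \<le> (f x)\<^sup>2 - 2 * m * f x + m\<^sup>2" for x
      using zero_le_power2[of "f x - m"] by (simp add: power2_diff algebra_simps)
  qed
  also have "\<dots> = integral {a..b} (\<lambda>x. (f x)\<^sup>2) - (integral {a..b} f)\<^sup>2 / (b - a)"
  proof -
    have "m * (b - a) = integral {a..b} f" using ab by (simp add: m_def)
    moreover have "(integral {a..b} f)\<^sup>2 / (b - a) = m * integral {a..b} f"
      by (simp add: m_def power2_eq_square)
    moreover have "(b - a) * m\<^sup>2 = m * (m * (b - a))" by (simp add: power2_eq_square)
    ultimately show ?thesis by simp
  qed
  finally show ?thesis using ab by (simp add: field_simps)
qed

lemma orthogonal_matrix_sub_id_bound:
  fixes h :: "real^'n^'n"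
  assumes "orthogonal_matrix h"
  obtains e where "e > 0" "\<And>y. e * norm (h *v y - y) \<le> norm (h *v (h *v y - y) - (h *v y - y))"
proof -
  define f where "f y = h *v y - y" for y
  have lin: "linear f" unfolding f_def
    by (intro linear_compose_sub matrix_vector_mul_linear linear_id[unfolded id_def])
  have "\<forall>x\<in>range f. f x = 0 \<longrightarrow> x = 0"
  proof (intro ballI impI)
    fix x assume "x \<in> range f" and x: "f x = 0"
    then obtain y where y: "x = h *v y - y" unfolding f_def by blast
    have "x \<bullet> (h *v y) = (h *v x) \<bullet> (h *v y)" using x by (simp add: f_def)
    also have "\<dots> = x \<bullet> y" by (rule orthogonal_matrix_inner[OF assms])
    finally have "x \<bullet> x = 0" by (subst (2) y) (simp add: inner_diff_right)
    then show "x = 0" by simp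
  qed
  then obtain e where "e > 0" "\<forall>x\<in>range f. e * norm x \<le> norm (f x)"
    using injective_imp_isometric[of "range f" f] lin
    by (metis closed_subspace linear_conv_bounded_linear linear_subspace_image subspace_UNIV)
  then show thesis using that unfolding f_def by blast
qed

lemma norm_orthogonal_mult:
  fixes Q :: "real^'n^'n"
  shows "orthogonal_matrix Q \<Longrightarrow> norm (Q *v x) = norm x"
  by (simp add: norm_eq_sqrt_inner orthogonal_matrix_inner)

text \<open>With D = d/d\<theta> + A the two differential equations say w = D g and v = D w. The
  inequality is stated for w in the image of D on periodic functions, because a nonzero periodic w
  with D w = 0 would violate it.\<close>

definition poincare_bound :: "real^'n^'n \<Rightarrow> real \<Rightarrow> bool" where
  "poincare_bound A C \<longleftrightarrow> (\<forall>g w v. (\<forall>\<theta>. (g has_vector_derivative (w \<theta> - A *v g \<theta>)) (at \<theta>)) \<longrightarrow>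
      (\<forall>\<theta>. (w has_vector_derivative (v \<theta> - A *v w \<theta>)) (at \<theta>)) \<longrightarrow> continuous_on UNIV v \<longrightarrow>
      g (2*pi) = g 0 \<longrightarrow> w (2*pi) = w 0 \<longrightarrow>
      integral {0..2*pi} (\<lambda>\<theta>. (norm (w \<theta>))\<^sup>2) \<le> C * integral {0..2*pi} (\<lambda>\<theta>. (norm (v \<theta>))\<^sup>2))"

text \<open>Let E s = exp(s A). Then E w has derivative E v, so it moves by at most I, the integral
  of |v|. Its mean a lies in the range of h - 1, because E w is the derivative of E g. As |h a - a|
  <= 3 I, the lower bound on that range controls a, then w 0, then all of w.\<close>

lemma poincare_twisted:
  fixes A :: "real^'n^'n"
  assumes orth: "\<And>s. orthogonal_matrix (mexp (s *\<^sub>R A))"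
  obtains C where "C > 0" "poincare_bound A C"
proof -
  define E where "E s = mexp (s *\<^sub>R A)" for s
  define h where "h = E (2*pi)"
  have oh: "orthogonal_matrix h" unfolding h_def E_def by (rule orth)
  obtain e where e: "e > 0" "\<And>y. e * norm (h *v y - y) \<le> norm (h *v (h *v y - y) - (h *v y - y))"
    using orthogonal_matrix_sub_id_bound[OF oh] by blast
  \<comment> \<open>The bound on a is 3 I / e; one more I leads from a to \<open>w 0\<close>, and
    another one from \<open>w 0\<close> to \<open>w \<theta>\<close>.\<close>
  define K where "K = 3 / e + 2"
  have K: "K > 0" unfolding K_def using e(1) by (simp add: add_pos_pos)
  show thesis
  proof (rule that[of "4 * pi\<^sup>2 * K\<^sup>2"])
    show "0 < 4 * pi\<^sup>2 * K\<^sup>2" using K by simp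
  next
    show "poincare_bound A (4 * pi\<^sup>2 * K\<^sup>2)"
      unfolding poincare_bound_def
    proof (intro allI impI)
      fix g w v :: "real \<Rightarrow> real^'n"
      assume g': "\<forall>\<theta>. (g has_vector_derivative (w \<theta> - A *v g \<theta>)) (at \<theta>)"
        and w': "\<forall>\<theta>. (w has_vector_derivative (v \<theta> - A *v w \<theta>)) (at \<theta>)"
        and v: "continuous_on UNIV v" and per: "g (2*pi) = g 0" "w (2*pi) = w 0"
      note g = g'[rule_format] and w = w'[rule_format]
      have cw: "continuous_on S w" for S
        using w by (meson continuous_at_imp_continuous_on has_vector_derivative_continuous)
      have cv: "continuous_on S v" for S using v continuous_on_subset by blast
      define I where "I = integral {0..2*pi} (\<lambda>\<theta>. norm (v \<theta>))"
      have I0: "I \<ge> 0" unfolding I_def by (intro integral_nonneg integrable_continuous_interval continuous_intros cv) auto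
      have W: "((\<lambda>s. E s *v w s) has_vector_derivative E s *v v s) (at s within S)" for s S
        unfolding E_def using mexp_apply_deriv[OF has_vector_derivative_at_within[OF w], of A s S] by simp
      have G: "((\<lambda>s. E s *v g s) has_vector_derivative E s *v w s) (at s within S)" for s S
        unfolding E_def using mexp_apply_deriv[OF has_vector_derivative_at_within[OF g], of A s S] by simp
      have E0: "E 0 *v x = x" for x by (simp add: E_def mexp_0)
      have nE: "norm (E s *v x) = norm x" for s x
        unfolding E_def by (rule norm_orthogonal_mult[OF orth])
      have osc: "norm (E \<theta> *v w \<theta> - w 0) \<le> I" if t: "\<theta> \<in> {0..2*pi}" for \<theta>
      proof -
        have "((\<lambda>s. E s *v v s) has_integral E \<theta> *v w \<theta> - E 0 *v w 0) {0..\<theta>}"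
          by (rule fundamental_theorem_of_calculus) (use t W in auto)
        then have "E \<theta> *v w \<theta> - w 0 = integral {0..\<theta>} (\<lambda>s. E s *v v s)"
          by (simp add: integral_unique E0)
        also have "norm \<dots> \<le> integral {0..\<theta>} (\<lambda>s. norm (v s))"
          by (rule integral_norm_bound_integral)
            (auto intro!: integrable_continuous_interval continuous_on_norm cv continuous_on_mexp_apply[where A=A, folded E_def] simp: nE)
        also have "\<dots> \<le> I" unfolding I_def using t
          by (intro integral_subset_le) (auto intro!: integrable_continuous_interval continuous_intros cv)
        finally show ?thesis .
      qed
      \<comment> \<open>By periodicity \<open>h *v w 0\<close> is the value of
        \<open>E s *v w s\<close> at the end of the period.\<close>
      have hw: "norm (h *v w 0 - w 0) \<le> I"
        using osc[of "2*pi"] per by (simp add: h_def)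
      \<comment> \<open>This is the mean of \<open>E s *v w s\<close>, written as the image of g 0 /
        (2 pi) under h - 1.\<close>
      define a where "a = h *v ((1/(2*pi)) *\<^sub>R g 0) - (1/(2*pi)) *\<^sub>R g 0"
      have "((\<lambda>s. E s *v w s) has_integral h *v g 0 - g 0) {0..2*pi}"
        using fundamental_theorem_of_calculus[OF _ G, of 0 "2*pi"] per by (simp add: h_def E0)
      from has_integral_diff[OF this has_integral_const_real[of "w 0"]]
      have int: "((\<lambda>s. E s *v w s - w 0) has_integral (h *v g 0 - g 0 - (2*pi) *\<^sub>R w 0)) {0..2*pi}"
        by simp
      have "norm (h *v g 0 - g 0 - (2*pi) *\<^sub>R w 0) \<le> I * measure lborel {0..2*pi}"
        by (rule has_integral_bound_real[OF _ finite.emptyI int]) (use I0 osc in auto)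
      moreover have "norm ((1/(2*pi)) *\<^sub>R X) \<le> I" if "norm X \<le> I * measure lborel {0..2*pi}" for X :: "real^'n"
        using that by (simp add: field_simps)
      ultimately have "norm ((1/(2*pi)) *\<^sub>R (h *v g 0 - g 0 - (2*pi) *\<^sub>R w 0)) \<le> I"
        by blast
      moreover have "(1/(2*pi)) *\<^sub>R (h *v g 0 - g 0 - (2*pi) *\<^sub>R w 0) = a - w 0"
        by (simp add: a_def algebra_simps)
      ultimately have aw: "norm (a - w 0) \<le> I" by simp
      have "e * norm a \<le> norm (h *v a - a)"
        using e(2)[of "(1/(2*pi)) *\<^sub>R g 0"] unfolding a_def .
      also have "h *v a - a = (h *v w 0 - w 0) + h *v (a - w 0) - (a - w 0)"
        by (simp add: algebra_simps)
      also have "norm \<dots> \<le> norm (h *v w 0 - w 0) + norm (h *v (a - w 0)) + norm (a - w 0)"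
        by (meson add_mono_thms_linordered_semiring(3) norm_triangle_ineq norm_triangle_ineq4 order_trans)
      also have "\<dots> \<le> 3 * I"
        using hw aw norm_orthogonal_mult[OF oh, of "a - w 0"] by simp
      finally have "norm a \<le> 3 / e * I" using e(1) by (simp add: field_simps)
      moreover have "norm (w 0) \<le> norm a + norm (a - w 0)" by (metis norm_triangle_sub add.commute norm_minus_commute)
      ultimately have w0: "norm (w 0) \<le> (3/e + 1) * I" using aw by (simp add: algebra_simps)
      have bound: "norm (w \<theta>) \<le> K * I" if "\<theta> \<in> {0..2*pi}" for \<theta>
      proof -
        have "norm (w \<theta>) = norm (E \<theta> *v w \<theta>)" by (simp add: nE)
        also have "\<dots> \<le> norm (w 0) + norm (E \<theta> *v w \<theta> - w 0)" by (rule norm_triangle_sub)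
        also have "\<dots> \<le> K * I" using w0 osc[OF that] by (simp add: K_def algebra_simps)
        finally show ?thesis .
      qed
      have "integral {0..2*pi} (\<lambda>\<theta>. (norm (w \<theta>))\<^sup>2) \<le> integral {0..2*pi} (\<lambda>\<theta>. (K * I)\<^sup>2)"
        by (intro integral_le integrable_continuous_interval continuous_intros cw power_mono bound) auto
      also have "\<dots> = 2 * pi * K\<^sup>2 * I\<^sup>2" by (simp add: power_mult_distrib)
      also have "\<dots> \<le> 2 * pi * K\<^sup>2 * (2 * pi * integral {0..2*pi} (\<lambda>\<theta>. (norm (v \<theta>))\<^sup>2))"
        using cauchy_schwarz_integral[of 0 "2*pi" "\<lambda>\<theta>. norm (v \<theta>)"] unfolding I_def
        by (intro mult_left_mono) (auto intro!: continuous_intros cv)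
      finally show "integral {0..2*pi} (\<lambda>\<theta>. (norm (w \<theta>))\<^sup>2)
          \<le> 4 * pi\<^sup>2 * K\<^sup>2 * integral {0..2*pi} (\<lambda>\<theta>. (norm (v \<theta>))\<^sup>2)"
        by (simp add: power2_eq_square mult_ac)
    qed
  qed
qed

section \<open>Normal vectors of a compact submanifold\<close>

text \<open>The intended \<Phi> k is the k-th directional derivative of an inverse chart along a
  line traversed by a sine. Then \<Phi> k has derivative cos(\<delta> s) \<Phi> (k+1), and the span
  of these products is closed under differentiation.\<close>

inductive trig_span :: "(nat \<Rightarrow> real \<Rightarrow> 'a::real_normed_vector) \<Rightarrow> real \<Rightarrow> (real \<Rightarrow> 'a) \<Rightarrow> bool"
  for \<Phi> \<delta> where
  base: "trig_span \<Phi> \<delta> (\<lambda>s. (cos (\<delta> * s) ^ a * sin (\<delta> * s) ^ b) *\<^sub>R \<Phi> k s)"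
| add: "trig_span \<Phi> \<delta> f \<Longrightarrow> trig_span \<Phi> \<delta> g \<Longrightarrow> trig_span \<Phi> \<delta> (\<lambda>s. f s + g s)"
| scale: "trig_span \<Phi> \<delta> f \<Longrightarrow> trig_span \<Phi> \<delta> (\<lambda>s. c *\<^sub>R f s)"

lemma trig_span_deriv:
  assumes \<Phi>: "\<And>k s. (\<Phi> k has_vector_derivative cos (\<delta> * s) *\<^sub>R \<Phi> (Suc k) s) (at s)"
    and "trig_span \<Phi> \<delta> f"
  shows "\<exists>g. trig_span \<Phi> \<delta> g \<and> (\<forall>s. (f has_vector_derivative g s) (at s))"
  using assms(2)
proof induction
  case (base a b k)
  \<comment> \<open>For a = 0 or b = 0 the truncated exponents \<open>a - 1\<close> and
    \<open>b - 1\<close> do no harm, as the coefficient in front is then 0.\<close>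
  let ?g = "\<lambda>s. (real a * - \<delta>) *\<^sub>R (cos (\<delta> * s) ^ (a - 1) * sin (\<delta> * s) ^ (b + 1)) *\<^sub>R \<Phi> k s +
    ((real b * \<delta>) *\<^sub>R (cos (\<delta> * s) ^ (a + 1) * sin (\<delta> * s) ^ (b - 1)) *\<^sub>R \<Phi> k s +
     (cos (\<delta> * s) ^ (a + 1) * sin (\<delta> * s) ^ b) *\<^sub>R \<Phi> (Suc k) s)"
  have "((\<lambda>s. (cos (\<delta> * s) ^ a * sin (\<delta> * s) ^ b) *\<^sub>R \<Phi> k s) has_vector_derivative ?g s) (at s)" for s
  proof -
    have "((\<lambda>s. cos (\<delta> * s) ^ a * sin (\<delta> * s) ^ b) has_real_derivative
        real a * - \<delta> * (cos (\<delta> * s) ^ (a - 1) * sin (\<delta> * s) ^ (b + 1)) +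
        real b * \<delta> * (cos (\<delta> * s) ^ (a + 1) * sin (\<delta> * s) ^ (b - 1))) (at s)"
    proof -
      have c: "((\<lambda>s. cos (\<delta> * s)) has_real_derivative - (sin (\<delta> * s) * \<delta>)) (at s)"
        by (rule DERIV_cong[OF DERIV_fun_cos[OF DERIV_cmult_Id]]) simp
      have s: "((\<lambda>s. sin (\<delta> * s)) has_real_derivative cos (\<delta> * s) * \<delta>) (at s)"
        by (rule DERIV_fun_sin[OF DERIV_cmult_Id])
      show ?thesis
        by (rule DERIV_cong[OF DERIV_mult[OF DERIV_power[OF c, of a] DERIV_power[OF s, of b]]]) (simp add: mult_ac)
    qed
    from has_vector_derivative_scaleR[OF this \<Phi>[of k s]] show ?thesis
      by (rule has_vector_derivative_eq_rhs) (simp add: scaleR_add_left scaleR_add_right scaleR_scaleR add_ac mult_ac scaleR_diff_left)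
  qed
  moreover have "trig_span \<Phi> \<delta> ?g"
    by (intro trig_span.add trig_span.scale) (rule trig_span.base)+
  ultimately show ?case by blast
next
  case (add f g)
  then obtain f' g' where "trig_span \<Phi> \<delta> f'" "\<And>s. (f has_vector_derivative f' s) (at s)"
    "trig_span \<Phi> \<delta> g'" "\<And>s. (g has_vector_derivative g' s) (at s)" by blast
  then show ?case
    by (intro exI[of _ "\<lambda>s. f' s + g' s"]) (auto intro!: trig_span.add has_vector_derivative_add)
next
  case (scale f c)
  then obtain f' where "trig_span \<Phi> \<delta> f'" "\<And>s. (f has_vector_derivative f' s) (at s)" by blast
  then show ?case
    by (intro exI[of _ "\<lambda>s. c *\<^sub>R f' s"]) (auto intro!: trig_span.scale derivative_eq_intros)
qed

lemma has_vector_derivative_along_curve: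
  assumes "smooth_on V \<psi>" "open V" "c s \<in> V" "(c has_vector_derivative a *\<^sub>R e) (at s)"
  shows "((\<lambda>s. \<psi> (c s)) has_vector_derivative a *\<^sub>R dderiv e \<psi> (c s)) (at s)"
proof -
  have d: "(\<psi> has_derivative (\<lambda>v. dderiv v \<psi> (c s))) (at (c s))"
    by (intro has_derivative_dderiv smooth_on_differentiable_at[OF assms(1-3)])
  interpret bounded_linear "\<lambda>v. dderiv v \<psi> (c s)" by (rule has_derivative_bounded_linear[OF d])
  show ?thesis
    using vector_derivative_diff_chain_within[OF assms(4) has_derivative_at_withinI[OF d]]
    by (simp add: o_def scaleR)
qed

text \<open>A tangent vector has to come from a globally defined curve, so the line in the chart is
  traversed with parameter \<open>s \<mapsto> sin (\<delta> s) / \<delta>\<close>, which keeps it inside the chart.\<close>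

lemma chart_curve:
  fixes \<psi> :: "'a::real_normed_vector \<Rightarrow> 'b::real_normed_vector"
  assumes \<psi>: "smooth_on V \<psi>" and V: "open V" and q: "q \<in> V"
  obtains \<gamma> :: "real \<Rightarrow> 'b" where "smooth_on UNIV \<gamma>" "\<gamma> 0 = \<psi> q" "dderiv 1 \<gamma> 0 = dderiv e \<psi> q"
    "\<And>s. \<exists>x. q + x *\<^sub>R e \<in> V \<and> \<gamma> s = \<psi> (q + x *\<^sub>R e)"
proof -
  obtain r where r: "r > 0" "ball q r \<subseteq> V" using V q open_contains_ball by blast
  \<comment> \<open>The displacement is at most |e| / \<delta> = r |e| / (|e| + 1) < r; the added 1
    also keeps \<delta> positive when e = 0.\<close>
  define \<delta> where "\<delta> = (norm e + 1) / r"
  have \<delta>: "\<delta> > 0" unfolding \<delta>_def using r by (simp add: add_nonneg_pos)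
  define c where "c s = q + (sin (\<delta> * s) / \<delta>) *\<^sub>R e" for s
  have cV: "c s \<in> V" for s
  proof -
    have "norm ((sin (\<delta> * s) / \<delta>) *\<^sub>R e) \<le> (1 / \<delta>) * norm e"
      using \<delta> by (simp add: divide_right_mono mult_left_le_one_le)
    also have "\<dots> < r"
      unfolding \<delta>_def using r add_pos_nonneg[OF zero_less_one norm_ge_zero[of e]]
      by (simp add: pos_divide_less_eq algebra_simps)
    finally show ?thesis using r(2) by (auto simp: c_def dist_norm)
  qed
  have cd: "(c has_vector_derivative cos (\<delta> * s) *\<^sub>R e) (at s)" for s
  proof -
    have "((\<lambda>s. sin (\<delta> * s) / \<delta>) has_real_derivative cos (\<delta> * s)) (at s)"
      using \<delta> by (auto intro!: derivative_eq_intros)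
    from has_vector_derivative_add[OF has_vector_derivative_const[of q]
        has_vector_derivative_scaleR[OF this has_vector_derivative_const[of e]]] show ?thesis
      unfolding c_def by (rule has_vector_derivative_eq_rhs) simp
  qed
  define \<Phi> where "\<Phi> k s = iter_dderiv (replicate k e) \<psi> (c s)" for k s
  have \<Phi>: "(\<Phi> k has_vector_derivative cos (\<delta> * s) *\<^sub>R \<Phi> (Suc k) s) (at s)" for k s
    using has_vector_derivative_along_curve[OF smooth_on_iter_dderiv[OF \<psi>] V cV cd, of "replicate k e"]
    unfolding \<Phi>_def by simp
  have "smooth_on UNIV (\<Phi> 0)"
  proof (rule smooth_curveI[where F = "Collect (trig_span \<Phi> \<delta>)"])
    show "\<Phi> 0 \<in> Collect (trig_span \<Phi> \<delta>)"
      using trig_span.base[of \<Phi> \<delta> 0 0 0] by simp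
    show "\<exists>g\<in>Collect (trig_span \<Phi> \<delta>). \<forall>s. (f has_vector_derivative g s) (at s)"
      if "f \<in> Collect (trig_span \<Phi> \<delta>)" for f
      using trig_span_deriv[of \<Phi> \<delta> f, OF \<Phi>] that by simp
  qed
  moreover have "dderiv 1 (\<Phi> 0) 0 = dderiv e \<psi> q"
    using dderiv_vector_derivative[OF \<Phi>[of 0 0], of 1] by (simp add: \<Phi>_def c_def)
  moreover have "\<Phi> 0 0 = \<psi> q" by (simp add: \<Phi>_def c_def)
  moreover have "\<exists>x. q + x *\<^sub>R e \<in> V \<and> \<Phi> 0 s = \<psi> (q + x *\<^sub>R e)" for s
    using cV[of s] by (auto simp: \<Phi>_def c_def)
  ultimately show thesis using that by blast
qed

section \<open>Derivative bounds on closed balls and the quadratic estimate for normal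
  vectors\<close>

lemma dderiv_basis_expansion:
  fixes f :: "'a::euclidean_space \<Rightarrow> 'b::real_normed_vector"
  assumes "f differentiable (at z)"
  shows "dderiv w f z = (\<Sum>b\<in>Basis. (w \<bullet> b) *\<^sub>R dderiv b f z)"
proof -
  interpret bounded_linear "\<lambda>v. dderiv v f z"
    using has_derivative_bounded_linear[OF has_derivative_dderiv[OF assms]] .
  have "dderiv w f z = dderiv (\<Sum>b\<in>Basis. (w \<bullet> b) *\<^sub>R b) f z"
    by (simp only: euclidean_representation)
  also have "\<dots> = (\<Sum>b\<in>Basis. (w \<bullet> b) *\<^sub>R dderiv b f z)"
    by (simp only: sum scaleR)
  finally show ?thesis .
qed

lemma smooth_on_bounded_cball:
  fixes f :: "'a::euclidean_space \<Rightarrow> 'b::real_normed_vector"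
  assumes f: "smooth_on V f" and V: "open V" "cball x r \<subseteq> V"
  shows "\<exists>B. B \<ge> 0 \<and> (\<forall>z\<in>cball x r. norm (f z) \<le> B)"
proof -
  have "continuous_on (cball x r) f"
    using smooth_on_differentiable_at[OF f V(1)] V(2) differentiable_imp_continuous_within
    by (blast intro: continuous_at_imp_continuous_on)
  then have "bounded (f ` cball x r)"
    using compact_continuous_image compact_imp_bounded compact_cball by blast
  then obtain B where "\<forall>z\<in>cball x r. norm (f z) \<le> B"
    unfolding bounded_iff by blast
  then show ?thesis by (intro exI[of _ "max B 0"]) (auto simp: le_max_iff_disj)
qed

lemma dderiv_bounded_cball:
  fixes f :: "'a::euclidean_space \<Rightarrow> 'b::real_normed_vector"
  assumes f: "smooth_on V f" and V: "open V" "cball x r \<subseteq> V"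
  shows "\<exists>L. L \<ge> 0 \<and> (\<forall>z\<in>cball x r. \<forall>w. norm (dderiv w f z) \<le> L * norm w)"
proof -
  have "\<forall>b. \<exists>B. B \<ge> 0 \<and> (\<forall>z\<in>cball x r. norm (dderiv b f z) \<le> B)"
    by (intro allI smooth_on_bounded_cball[OF smooth_on_dderiv[OF f] V])
  from choice[OF this] obtain B where
    B: "\<And>b. B b \<ge> 0" "\<And>b z. z \<in> cball x r \<Longrightarrow> norm (dderiv b f z) \<le> B b" by blast
  show ?thesis
  proof (intro exI[of _ "\<Sum>b\<in>Basis. B b"] conjI ballI allI)
    show "0 \<le> (\<Sum>b\<in>Basis. B b)" using B(1) by (simp add: sum_nonneg)
    fix z w :: 'a assume z: "z \<in> cball x r"
    have "norm (dderiv w f z) = norm (\<Sum>b\<in>Basis. (w \<bullet> b) *\<^sub>R dderiv b f z)"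
      using dderiv_basis_expansion[OF smooth_on_differentiable_at[OF f V(1) subsetD[OF V(2) z]], of w]
      by (rule arg_cong)
    also have "\<dots> \<le> (\<Sum>b\<in>Basis. norm w * B b)"
      by (intro sum_norm_le) (auto intro!: mult_mono Basis_le_norm B(2) z)
    finally show "norm (dderiv w f z) \<le> (\<Sum>b\<in>Basis. B b) * norm w"
      by (simp add: sum_distrib_left sum_distrib_right mult_ac)
  qed
qed

text \<open>The inner derivative is expanded in the basis with the constant coefficients
  \<open>w \<bullet> b\<close>. This reduces the claim to the first order bound for finitely many
  functions.\<close>

lemma dderiv2_bounded_cball:
  fixes f :: "'a::euclidean_space \<Rightarrow> 'b::real_normed_vector"
  assumes f: "smooth_on V f" and V: "open V" "cball x r \<subseteq> V"
  shows "\<exists>K. K \<ge> 0 \<and> (\<forall>z\<in>cball x r. \<forall>w. norm (dderiv w (dderiv w f) z) \<le> K * (norm w)\<^sup>2)"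
proof -
  have "\<forall>b. \<exists>B. B \<ge> 0 \<and> (\<forall>z\<in>cball x r. \<forall>w. norm (dderiv w (dderiv b f) z) \<le> B * norm w)"
    by (intro allI dderiv_bounded_cball[OF smooth_on_dderiv[OF f] V])
  from choice[OF this] obtain B where B: "\<And>b. B b \<ge> 0"
    "\<And>b z w. z \<in> cball x r \<Longrightarrow> norm (dderiv w (dderiv b f) z) \<le> B b * norm w" by blast
  show ?thesis
  proof (intro exI[of _ "\<Sum>b\<in>Basis. B b"] conjI ballI allI)
    show "0 \<le> (\<Sum>b\<in>Basis. B b)" using B(1) by (simp add: sum_nonneg)
    fix z w :: 'a assume z: "z \<in> cball x r"
    then have zV: "z \<in> V" using V(2) by blast
    have der: "((\<lambda>y. \<Sum>b\<in>Basis. (w \<bullet> b) *\<^sub>R dderiv b f y) has_derivative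
        (\<lambda>v. \<Sum>b\<in>Basis. (w \<bullet> b) *\<^sub>R dderiv v (dderiv b f) z)) (at z)"
      by (intro has_derivative_sum has_derivative_scaleR_right has_derivative_dderiv
          smooth_on_differentiable_at[OF smooth_on_dderiv[OF f] V(1) zV])
    have "dderiv w (dderiv w f) z = dderiv w (\<lambda>y. \<Sum>b\<in>Basis. (w \<bullet> b) *\<^sub>R dderiv b f y) z"
    proof (rule dderiv_eq_on_open[OF V(1) zV])
      show "dderiv w f y = (\<Sum>b\<in>Basis. (w \<bullet> b) *\<^sub>R dderiv b f y)" if "y \<in> V" for y
        by (rule dderiv_basis_expansion[OF smooth_on_differentiable_at[OF f V(1) that]])
      show "(\<lambda>y. \<Sum>b\<in>Basis. (w \<bullet> b) *\<^sub>R dderiv b f y) differentiable at z"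
        using der unfolding differentiable_def by blast
    qed
    also have "\<dots> = (\<Sum>b\<in>Basis. (w \<bullet> b) *\<^sub>R dderiv w (dderiv b f) z)"
      by (rule dderiv_eq[OF der])
    also have "norm \<dots> \<le> (\<Sum>b\<in>Basis. norm w * (B b * norm w))"
      by (intro sum_norm_le) (auto intro!: mult_mono Basis_le_norm B(2) z)
    finally show "norm (dderiv w (dderiv w f) z) \<le> (\<Sum>b\<in>Basis. B b) * (norm w)\<^sup>2"
      by (simp add: sum_distrib_left sum_distrib_right mult_ac power2_eq_square)
  qed
qed

text \<open>The chart sends p and q into the linear space E, so w = \<phi> q - \<phi> p lies in E.
  In the Taylor expansion of <\<psi> (x + s w), n> in s the linear term vanishes, because the
  derivative of \<psi> along w is tangent to M at p. The remainder is at most K |w|^2 |n|, and |w|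
  <= L |q - p|.\<close>

lemma submanifold_normal_local:
  fixes M :: "(real^'n) set"
  assumes M: "embedded_submanifold d M" and p0: "p0 \<in> M"
  obtains r C where "r > 0" "C \<ge> 0" "\<And>p q n. \<lbrakk>p \<in> M; q \<in> M; p \<in> ball p0 r; q \<in> ball p0 r;
    \<forall>v\<in>tangent_space M p. n \<bullet> v = 0\<rbrakk> \<Longrightarrow> (q - p) \<bullet> n \<le> C * (norm (q - p))\<^sup>2 * norm n"
proof -
  obtain U V and \<phi> \<psi> :: "real^'n \<Rightarrow> real^'n" and E where ch:
    "open U" "p0 \<in> U" "open V" "smooth_on U \<phi>" "smooth_on V \<psi>" "\<phi> ` U = V" "\<forall>x\<in>U. \<psi> (\<phi> x) = x"
    "subspace E" "\<phi> ` (M \<inter> U) = E \<inter> V"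
    using M p0 unfolding embedded_submanifold_def by meson
  have "\<phi> p0 \<in> V" using ch by blast
  then obtain r1 where r1: "r1 > 0" "cball (\<phi> p0) r1 \<subseteq> V" using ch(3) open_contains_cball by blast
  obtain K where K: "K \<ge> 0"
    "\<And>z w. z \<in> cball (\<phi> p0) r1 \<Longrightarrow> norm (dderiv w (dderiv w \<psi>) z) \<le> K * (norm w)\<^sup>2"
    using dderiv2_bounded_cball[OF ch(5,3) r1(2)] by blast
  obtain r2 where r2: "r2 > 0" "cball p0 r2 \<subseteq> U" using ch(1,2) open_contains_cball by blast
  obtain L where L: "L \<ge> 0" "\<And>z w. z \<in> cball p0 r2 \<Longrightarrow> norm (dderiv w \<phi> z) \<le> L * norm w"
    using dderiv_bounded_cball[OF ch(4,1) r2(2)] by blast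
  have lip: "norm (\<phi> q - \<phi> p) \<le> L * norm (q - p)" if "p \<in> cball p0 r2" "q \<in> cball p0 r2" for p q
  proof (rule differentiable_bound[OF convex_cball, where f = \<phi> and f' = "\<lambda>z v. dderiv v \<phi> z"])
    show "(\<phi> has_derivative (\<lambda>v. dderiv v \<phi> z)) (at z within cball p0 r2)" if "z \<in> cball p0 r2" for z
      by (rule has_derivative_at_withinI[OF has_derivative_dderiv[OF
            smooth_on_differentiable_at[OF ch(4,1) subsetD[OF r2(2) that]]]])
    show "onorm (\<lambda>v. dderiv v \<phi> z) \<le> L" if "z \<in> cball p0 r2" for z
      using L(2)[OF that] by (rule onorm_le)
  qed (use that in auto)
  \<comment> \<open>\<phi> is L-Lipschitz near p0, so the ball of radius r is sent into the convex
    ball of radius r1, which then contains the whole segment. Dividing by L + 1 covers L =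
    0.\<close>
  define r where "r = min r2 (r1 / (L + 1))"
  have r: "r > 0" using r1 r2 L(1) by (simp add: r_def)
  have Lr: "L * r \<le> r1"
  proof -
    have "L * r \<le> (L + 1) * (r1 / (L + 1))" using L(1) r r1 by (intro mult_mono) (auto simp: r_def)
    also have "(L + 1) * (r1 / (L + 1)) = r1" using L(1) by simp
    finally show ?thesis .
  qed
  show thesis
  proof (rule that[of r "K * L\<^sup>2"])
    fix p q n
    assume pq: "p \<in> M" "q \<in> M" "p \<in> ball p0 r" "q \<in> ball p0 r" and n: "\<forall>v\<in>tangent_space M p. n \<bullet> v = 0"
    have c2: "p \<in> cball p0 r2" "q \<in> cball p0 r2" "p0 \<in> cball p0 r2" using pq r2 by (auto simp: r_def)
    have pqU: "p \<in> U" "q \<in> U" using c2 r2(2) by auto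
    define x w where "x = \<phi> p" and "w = \<phi> q - \<phi> p"
    have in1: "\<phi> y \<in> cball (\<phi> p0) r1" if "y \<in> cball p0 r2" "y \<in> ball p0 r" for y
    proof -
      have "norm (\<phi> y - \<phi> p0) \<le> L * norm (y - p0)" using lip that c2 by blast
      also have "\<dots> \<le> L * r" using that L by (intro mult_left_mono) (auto simp: dist_norm norm_minus_commute)
      finally show ?thesis using Lr by (simp add: dist_norm norm_minus_commute)
    qed
    have EV: "\<phi> p \<in> E \<inter> V" "\<phi> q \<in> E \<inter> V" using pq pqU ch(9) by blast+
    have wE: "w \<in> E" unfolding w_def using EV ch(8) by (simp add: subspace_diff)
    have seg: "x + s *\<^sub>R w \<in> cball (\<phi> p0) r1" if "0 \<le> s" "s \<le> 1" for s
    proof -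
      have "x + s *\<^sub>R w = (1 - s) *\<^sub>R \<phi> p + s *\<^sub>R \<phi> q" by (simp add: x_def w_def algebra_simps)
      then show ?thesis using convexD_alt[OF convex_cball in1 in1 that] c2 pq by metis
    qed
    have line: "((\<lambda>s. x + s *\<^sub>R w) has_vector_derivative 1 *\<^sub>R w) (at s)" for s
      by (auto intro!: derivative_eq_intros)
    have d1: "((\<lambda>s. g (x + s *\<^sub>R w) \<bullet> n) has_real_derivative dderiv w g (x + s *\<^sub>R w) \<bullet> n) (at s)"
      if "smooth_on V g" "0 \<le> s" "s \<le> 1" for g :: "real^'n \<Rightarrow> real^'n" and s
    proof -
      have "((\<lambda>s. g (x + s *\<^sub>R w)) has_vector_derivative 1 *\<^sub>R dderiv w g (x + s *\<^sub>R w)) (at s)"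
        by (rule has_vector_derivative_along_curve[OF that(1) ch(3) _ line]) (use seg[OF that(2,3)] r1(2) in auto)
      from bounded_linear.has_vector_derivative[OF bounded_linear_inner_left this, of n] show ?thesis
        by (simp add: has_real_derivative_iff_has_vector_derivative)
    qed
    \<comment> \<open>The line through x in direction w stays in E, so its points inside V are chart
      images of points of M. Hence \<psi> carries the curve of \<open>chart_curve\<close> into
      M.\<close>
    have tan: "dderiv w \<psi> x \<in> tangent_space M p"
    proof -
      have "x \<in> V" using EV x_def by blast
      obtain \<gamma> :: "real \<Rightarrow> real^'n" where \<gamma>: "smooth_on UNIV \<gamma>" "\<gamma> 0 = \<psi> x" "dderiv 1 \<gamma> 0 = dderiv w \<psi> x"
        "\<And>s. \<exists>y. x + y *\<^sub>R w \<in> V \<and> \<gamma> s = \<psi> (x + y *\<^sub>R w)"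
        using chart_curve[OF ch(5,3) \<open>x \<in> V\<close>] by metis
      have "\<gamma> s \<in> M" for s
      proof -
        obtain y where y: "x + y *\<^sub>R w \<in> V" "\<gamma> s = \<psi> (x + y *\<^sub>R w)" using \<gamma>(4) by blast
        have "x + y *\<^sub>R w \<in> E" using EV wE ch(8) by (simp add: x_def subspace_add subspace_scale)
        then have "x + y *\<^sub>R w \<in> \<phi> ` (M \<inter> U)" using y ch(9) by blast
        then show ?thesis using y(2) ch(7) by auto
      qed
      moreover have "\<gamma> 0 = p" using \<gamma>(2) ch(7) pqU by (simp add: x_def)
      ultimately show ?thesis using \<gamma> unfolding tangent_space_def by blast
    qed
    define f where "f m = (if m = 0 then (\<lambda>s. \<psi> (x + s *\<^sub>R w) \<bullet> n) else if m = 1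
       then (\<lambda>s. dderiv w \<psi> (x + s *\<^sub>R w) \<bullet> n) else (\<lambda>s. dderiv w (dderiv w \<psi>) (x + s *\<^sub>R w) \<bullet> n))" for m :: nat
    have "\<forall>m t. m < 2 \<and> 0 \<le> t \<and> t \<le> 1 \<longrightarrow> DERIV (f m) t :> f (Suc m) t"
      using d1 ch(5) smooth_on_dderiv[OF ch(5)] by (auto simp: f_def less_2_cases_iff)
    \<comment> \<open>Expansion at 0 evaluated at 1: the terms of order 0 and 1, and the remainder
      \<open>f 2 t / 2\<close>.\<close>
    from Taylor_up[OF _ refl this, of 0] obtain t where t: "0 < t" "t < 1"
      "f 0 1 = (\<Sum>m<2. f m 0 / fact m * (1 - 0) ^ m) + f 2 t / fact 2 * (1 - 0)\<^sup>2" by auto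
    have "(\<Sum>m<2. f m 0 / fact m * (1 - 0) ^ m) = f 0 0 + f 1 0" by (simp add: numeral_2_eq_2)
    moreover have "f 1 0 = 0" using bspec[OF n tan] by (simp add: f_def inner_commute)
    moreover have "f 0 1 = q \<bullet> n" "f 0 0 = p \<bullet> n" using ch(7) pqU by (simp_all add: f_def x_def w_def)
    ultimately have "(q - p) \<bullet> n = f 2 t / 2" using t(3) by (simp add: inner_diff_left)
    also have "f 2 t \<le> norm (dderiv w (dderiv w \<psi>) (x + t *\<^sub>R w)) * norm n"
      by (simp add: f_def norm_cauchy_schwarz)
    also have "\<dots> \<le> K * (norm w)\<^sup>2 * norm n"
      using K(2)[OF seg] t by (intro mult_right_mono) auto
    also have "\<dots> \<le> K * (L * norm (q - p))\<^sup>2 * norm n"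
      using lip[OF c2(1,2)] K(1) by (intro mult_right_mono mult_left_mono power_mono) (auto simp: w_def)
    finally have "(q - p) \<bullet> n \<le> K * L\<^sup>2 * (norm (q - p))\<^sup>2 * norm n / 2"
      by (simp add: power_mult_distrib mult_ac)
    also have "\<dots> \<le> K * L\<^sup>2 * (norm (q - p))\<^sup>2 * norm n"
      using K(1) by simp
    finally show "(q - p) \<bullet> n \<le> K * L\<^sup>2 * (norm (q - p))\<^sup>2 * norm n" .
  qed (use r K(1) in auto)
qed

text \<open>Close pairs are covered by the local estimate. If |q - p| >= r / 2, Cauchy-Schwarz
  suffices, since then |q - p| <= (2 / r) |q - p|^2. Compactness leaves finitely many
  centres.\<close>

lemma submanifold_normal_global:
  fixes M :: "(real^'n) set"
  assumes M: "embedded_submanifold d M" "compact M"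
  obtains C where "C > 0" "\<And>p q n. \<lbrakk>p \<in> M; q \<in> M; \<forall>v\<in>tangent_space M p. n \<bullet> v = 0\<rbrakk> \<Longrightarrow>
    (q - p) \<bullet> n \<le> C * (norm (q - p))\<^sup>2 * norm n"
proof -
  define P where "P p0 r C \<longleftrightarrow> r > 0 \<and> C \<ge> 0 \<and> (\<forall>p\<in>M \<inter> ball p0 r. \<forall>q\<in>M. \<forall>n.
      (\<forall>v\<in>tangent_space M p. n \<bullet> v = 0) \<longrightarrow> (q - p) \<bullet> n \<le> C * (norm (q - p))\<^sup>2 * norm n)"
    for p0 r C
  have "\<exists>r C. P p0 r C" if p0: "p0 \<in> M" for p0
  proof -
    obtain r C where r: "r > 0" and C: "C \<ge> 0" and loc: "\<And>p q n. \<lbrakk>p \<in> M; q \<in> M; p \<in> ball p0 r; q \<in> ball p0 r;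
      \<forall>v\<in>tangent_space M p. n \<bullet> v = 0\<rbrakk> \<Longrightarrow> (q - p) \<bullet> n \<le> C * (norm (q - p))\<^sup>2 * norm n"
      by (rule submanifold_normal_local[OF M(1) p0]) (rule that, assumption+)
    \<comment> \<open>Halving the radius for p ensures that q is either in the ball of radius r
      about p0 or at distance at least r / 2 from p.\<close>
    have "(q - p) \<bullet> n \<le> (C + 2 / r) * (norm (q - p))\<^sup>2 * norm n"
      if pq: "p \<in> M" "p \<in> ball p0 (r/2)" "q \<in> M" and n: "\<forall>v\<in>tangent_space M p. n \<bullet> v = 0" for p q n
    proof (cases "norm (q - p) < r / 2")
      case True
      have "dist p0 q \<le> dist p0 p + dist p q" by (rule dist_triangle)
      then have "q \<in> ball p0 r" using True pq(2) by (simp add: dist_norm norm_minus_commute)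
      then have "(q - p) \<bullet> n \<le> C * (norm (q - p))\<^sup>2 * norm n" using loc pq n r by auto
      also have "\<dots> \<le> (C + 2 / r) * (norm (q - p))\<^sup>2 * norm n"
        using r by (intro mult_right_mono) auto
      finally show ?thesis .
    next
      case False
      have "(q - p) \<bullet> n \<le> 1 * norm (q - p) * norm n" by (simp add: norm_cauchy_schwarz)
      also have "\<dots> \<le> (2 / r * norm (q - p)) * norm (q - p) * norm n"
        using False r by (intro mult_right_mono) (auto simp: field_simps)
      also have "\<dots> \<le> ((C + 2 / r) * norm (q - p)) * norm (q - p) * norm n"
        using C by (intro mult_right_mono) auto
      finally show ?thesis by (simp add: power2_eq_square mult_ac)
    qed
    then have "P p0 (r/2) (C + 2/r)" using r C by (auto simp: P_def)
    then show ?thesis by blast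
  qed
  then obtain r C where "\<And>p0. p0 \<in> M \<Longrightarrow> P p0 (r p0) (C p0)" by metis
  then have rC: "\<And>p0. p0 \<in> M \<Longrightarrow> r p0 > 0" "\<And>p0. p0 \<in> M \<Longrightarrow> C p0 \<ge> 0"
    "\<And>p0 p q n. \<lbrakk>p0 \<in> M; p \<in> M; p \<in> ball p0 (r p0); q \<in> M; \<forall>v\<in>tangent_space M p. n \<bullet> v = 0\<rbrakk> \<Longrightarrow>
      (q - p) \<bullet> n \<le> C p0 * (norm (q - p))\<^sup>2 * norm n"
    unfolding P_def by auto
  have "M \<subseteq> (\<Union>p0\<in>M. ball p0 (r p0))" using rC(1) by auto
  then obtain D where D: "D \<subseteq> M" "finite D" "M \<subseteq> (\<Union>p0\<in>D. ball p0 (r p0))"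
    using compactE_image[OF M(2), of M "\<lambda>p0. ball p0 (r p0)"] by auto
  show thesis
  \<comment> \<open>The sum dominates each of the finitely many constants, and the 1 makes the
    result positive even if all of them vanish.\<close>
  proof (rule that[of "(\<Sum>p0\<in>D. C p0) + 1"])
    have "0 \<le> (\<Sum>p0\<in>D. C p0)" using rC(2) D(1) by (auto intro!: sum_nonneg)
    then show "(\<Sum>p0\<in>D. C p0) + 1 > 0" by simp
    fix p q n assume pq: "p \<in> M" "q \<in> M" and n: "\<forall>v\<in>tangent_space M p. n \<bullet> v = 0"
    obtain p0 where p0: "p0 \<in> D" "p \<in> ball p0 (r p0)" using pq D by blast
    have "(q - p) \<bullet> n \<le> C p0 * (norm (q - p))\<^sup>2 * norm n" using rC(3) p0 D(1) pq n by blast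
    also have "C p0 \<le> (\<Sum>p0\<in>D. C p0)" using D rC(2) p0 by (intro member_le_sum) auto
    finally show "(q - p) \<bullet> n \<le> ((\<Sum>p0\<in>D. C p0) + 1) * (norm (q - p))\<^sup>2 * norm n"
      by (smt (verit) mult_right_mono norm_ge_zero zero_le_power2)
  qed
qed

lemma second_derivative_nonpos_at_max:
  fixes g :: "real \<Rightarrow> real"
  assumes g: "\<And>s. (g has_real_derivative g1 s) (at s)" and g1: "(g1 has_real_derivative g2) (at 0)"
    and "g1 0 = 0" and max: "\<And>s. g s \<le> g 0"
  shows "g2 \<le> 0"
proof (rule ccontr)
  assume "\<not> g2 \<le> 0"
  then obtain d where d: "d > 0" "\<And>h. 0 < h \<Longrightarrow> h < d \<Longrightarrow> g1 0 < g1 (0 + h)"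
    using DERIV_pos_inc_right[OF g1] by auto
  obtain z where z: "0 < z" "z < d/2" "g (d/2) - g 0 = (d/2 - 0) * g1 z"
    using MVT2[of 0 "d/2" g g1] g d(1) by auto
  have "g1 z > 0" using d(2)[of z] z assms(3) by auto
  then have "(d/2 - 0) * g1 z > 0" using d(1) by simp
  then show False using max[of "d/2"] z(3) by linarith
qed

lemma inner_has_real_derivative:
  fixes f g :: "real \<Rightarrow> 'a::real_inner"
  assumes "(f has_vector_derivative f') (at s within S)" "(g has_vector_derivative g') (at s within S)"
  shows "((\<lambda>s. f s \<bullet> g s) has_real_derivative f s \<bullet> g' + f' \<bullet> g s) (at s within S)"
  using bounded_bilinear.has_vector_derivative[OF bounded_bilinear_inner assms]
  by (simp add: has_real_derivative_iff_has_vector_derivative)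

text \<open>By the inequality, <c s - c 0, n> - C |n| |c s - c 0|^2 has its maximum 0 at s = 0, so
  its second derivative there is nonpositive. This plays the part of a bound on the second
  fundamental form in direction n.\<close>

lemma normal_curvature_bound:
  fixes c :: "real \<Rightarrow> real^'n"
  assumes ineq: "\<And>q. q \<in> M \<Longrightarrow> (q - c 0) \<bullet> n \<le> C * (norm (q - c 0))\<^sup>2 * norm n"
    and c: "\<And>s. c s \<in> M" "\<And>s. (c has_vector_derivative c1 s) (at s)" "(c1 has_vector_derivative c2) (at 0)"
    and n: "c1 0 \<bullet> n = 0"
  shows "c2 \<bullet> n \<le> 2 * C * (norm (c1 0))\<^sup>2 * norm n"
proof -
  define k where "k = C * norm n"
  define g where "g s = (c s - c 0) \<bullet> n - k * ((c s - c 0) \<bullet> (c s - c 0))" for s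
  define g1 where "g1 s = c1 s \<bullet> n - 2 * k * ((c s - c 0) \<bullet> c1 s)" for s
  have cd: "((\<lambda>s. c s - c 0) has_vector_derivative c1 s) (at s)" for s
    using has_vector_derivative_diff[OF c(2) has_vector_derivative_const] by simp
  note const = has_vector_derivative_const[of n]
  have "(g has_real_derivative g1 s) (at s)" for s
    unfolding g_def
    by (rule DERIV_cong[OF DERIV_diff[OF inner_has_real_derivative[OF cd const]
            DERIV_cmult[OF inner_has_real_derivative[OF cd cd]]]])
      (simp add: g1_def inner_commute)
  moreover have "(g1 has_real_derivative (c2 \<bullet> n - 2 * k * (c1 0 \<bullet> c1 0))) (at 0)"
    unfolding g1_def
    by (rule DERIV_cong[OF DERIV_diff[OF inner_has_real_derivative[OF c(3) const]
            DERIV_cmult[OF inner_has_real_derivative[OF cd c(3)]]]]) simp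
  moreover have "g1 0 = 0" by (simp add: g1_def n)
  moreover have "g s \<le> g 0" for s
    using ineq[OF c(1)[of s]] by (simp add: g_def k_def power2_norm_eq_inner mult_ac)
  ultimately have "c2 \<bullet> n - 2 * k * (c1 0 \<bullet> c1 0) \<le> 0" by (rule second_derivative_nonpos_at_max)
  then show ?thesis by (simp add: k_def power2_norm_eq_inner mult_ac)
qed

section \<open>The mean value inequality and Heinz' estimate\<close>

text \<open>Fubini and translation invariance in one variable. Shears are the building blocks for
  the rotation invariance of plane Lebesgue measure.\<close>

lemma nn_integral_shear_fst:
  fixes f :: "real \<times> real \<Rightarrow> ennreal"
  assumes [measurable]: "f \<in> borel_measurable borel"
  shows "(\<integral>\<^sup>+z. f (fst z + a * snd z, snd z) \<partial>lborel) = (\<integral>\<^sup>+z. f z \<partial>lborel)"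
proof -
  have m: "(\<lambda>z::real \<times> real. (fst z + a * snd z, snd z)) \<in> borel_measurable borel"
    by (intro borel_measurable_continuous_onI continuous_intros)
  have "(\<integral>\<^sup>+z. f (fst z + a * snd z, snd z) \<partial>lborel) =
      (\<integral>\<^sup>+y. (\<integral>\<^sup>+x. f (x + a * y, y) \<partial>lborel) \<partial>lborel)"
    using measurable_compose[OF m assms]
    by (subst lborel_prod[symmetric], subst lborel_pair.nn_integral_snd[symmetric])
      (auto simp: lborel_prod)
  also have "\<dots> = (\<integral>\<^sup>+y. (\<integral>\<^sup>+x. f (x, y) \<partial>lborel) \<partial>lborel)"
  proof (rule nn_integral_cong)
    fix y :: real
    show "(\<integral>\<^sup>+x. f (x + a * y, y) \<partial>lborel) = (\<integral>\<^sup>+x. f (x, y) \<partial>lborel)"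
      by (subst nn_integral_real_affine[of "\<lambda>x. f (x, y)" 1 "a * y"]) (auto simp: add.commute)
  qed
  also have "\<dots> = (\<integral>\<^sup>+z. f z \<partial>lborel)"
    by (subst lborel_pair.nn_integral_snd) (auto simp: lborel_prod)
  finally show ?thesis .
qed

lemma nn_integral_shear_snd:
  fixes f :: "real \<times> real \<Rightarrow> ennreal"
  assumes [measurable]: "f \<in> borel_measurable borel"
  shows "(\<integral>\<^sup>+z. f (fst z, snd z + a * fst z) \<partial>lborel) = (\<integral>\<^sup>+z. f z \<partial>lborel)"
proof -
  have m: "(\<lambda>z::real \<times> real. (fst z, snd z + a * fst z)) \<in> borel_measurable borel"
    by (intro borel_measurable_continuous_onI continuous_intros)
  have "(\<integral>\<^sup>+z. f (fst z, snd z + a * fst z) \<partial>lborel) =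
      (\<integral>\<^sup>+x. (\<integral>\<^sup>+y. f (x, y + a * x) \<partial>lborel) \<partial>lborel)"
    using measurable_compose[OF m assms]
    by (subst lborel_prod[symmetric], subst lborel.nn_integral_fst[symmetric])
      (auto simp: lborel_prod)
  also have "\<dots> = (\<integral>\<^sup>+x. (\<integral>\<^sup>+y. f (x, y) \<partial>lborel) \<partial>lborel)"
  proof (rule nn_integral_cong)
    fix x :: real
    show "(\<integral>\<^sup>+y. f (x, y + a * x) \<partial>lborel) = (\<integral>\<^sup>+y. f (x, y) \<partial>lborel)"
      by (subst nn_integral_real_affine[of "\<lambda>y. f (x, y)" 1 "a * x"]) (auto simp: add.commute)
  qed
  also have "\<dots> = (\<integral>\<^sup>+z. f z \<partial>lborel)"
    by (subst lborel.nn_integral_fst) (auto simp: lborel_prod)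
  finally show ?thesis .
qed

definition rot :: "real \<Rightarrow> real \<Rightarrow> real \<times> real \<Rightarrow> real \<times> real" where
  "rot c s z = (c * fst z - s * snd z, s * fst z + c * snd z)"

lemma borel_measurable_rot [measurable]: "rot c s \<in> borel_measurable borel"
  unfolding rot_def by (intro borel_measurable_continuous_onI continuous_intros)

lemma norm_rot:
  assumes "c\<^sup>2 + s\<^sup>2 = 1"
  shows "norm (rot c s z) = norm z"
proof -
  have "(c * fst z - s * snd z)\<^sup>2 + (s * fst z + c * snd z)\<^sup>2 = (c\<^sup>2 + s\<^sup>2) * ((fst z)\<^sup>2 + (snd z)\<^sup>2)"
    by (simp add: power2_eq_square algebra_simps)
  then show ?thesis by (simp add: rot_def norm_prod_def assms)
qed

text \<open>A rotation by an angle other than \<open>\<pi>\<close> is a product of three shears.\<close>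

lemma nn_integral_rot:
  fixes f :: "real \<times> real \<Rightarrow> ennreal"
  assumes [measurable]: "f \<in> borel_measurable borel" and cs: "c\<^sup>2 + s\<^sup>2 = 1"
  shows "(\<integral>\<^sup>+z. f (rot c s z) \<partial>lborel) = (\<integral>\<^sup>+z. f z \<partial>lborel)"
proof -
  have generic: "(\<integral>\<^sup>+z. f (rot c s z) \<partial>lborel) = (\<integral>\<^sup>+z. f z \<partial>lborel)"
    if cs: "c\<^sup>2 + s\<^sup>2 = 1" and c: "c \<noteq> -1" and [measurable]: "f \<in> borel_measurable borel"
    for c s and f :: "real \<times> real \<Rightarrow> ennreal"
  proof -
    \<comment> \<open>The tangent of half the angle. The shears with factors -t, s, -t compose to
      the rotation because t (1 + c) = s and t s = 1 - c.\<close>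
    define t where "t = s / (1 + c)"
    have c': "1 + c \<noteq> 0" using c by auto
    have t1: "t * (1 + c) = s" using c' by (simp add: t_def)
    have "s * s = (1 - c) * (1 + c)" using cs by (simp add: power2_eq_square algebra_simps)
    then have t2: "t * s = 1 - c" using c' by (simp add: t_def)
    define g where "g z = f (fst z + (- t) * snd z, snd z)" for z
    define h where "h z = g (fst z, snd z + s * fst z)" for z
    have [measurable]: "g \<in> borel_measurable borel" "h \<in> borel_measurable borel"
      unfolding h_def g_def by (auto simp: borel_prod[symmetric])
    have "f (rot c s z) = h (fst z + (- t) * snd z, snd z)" for z
    proof -
      obtain x y where z: "z = (x, y)" by fastforce
      have "y + s * (x + (- t) * y) = s * x + (1 - t * s) * y" by (simp add: algebra_simps)
      then have e2: "y + s * (x + (- t) * y) = s * x + c * y" by (simp add: t2)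
      have "x + (- t) * y + (- t) * (s * x + c * y) = x * (1 - t * s) - y * (t * (1 + c))"
        by (simp add: algebra_simps)
      also have "\<dots> = c * x - s * y" by (simp add: t1 t2)
      finally show ?thesis using e2 by (simp add: z rot_def h_def g_def)
    qed
    then have "(\<integral>\<^sup>+z. f (rot c s z) \<partial>lborel) = (\<integral>\<^sup>+z. h (fst z + (- t) * snd z, snd z) \<partial>lborel)"
      by simp
    also have "\<dots> = (\<integral>\<^sup>+z. h z \<partial>lborel)" by (rule nn_integral_shear_fst) measurable
    also have "\<dots> = (\<integral>\<^sup>+z. g z \<partial>lborel)" unfolding h_def by (rule nn_integral_shear_snd) measurable
    also have "\<dots> = (\<integral>\<^sup>+z. f z \<partial>lborel)" unfolding g_def by (rule nn_integral_shear_fst) measurable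
    finally show ?thesis .
  qed
  show ?thesis
  proof (cases "c = -1")
    \<comment> \<open>The half turn, for which t is undefined, is taken as two quarter
      turns.\<close>
    case True
    then have "s = 0" using cs by simp
    have "(\<integral>\<^sup>+z. f (rot c s z) \<partial>lborel) = (\<integral>\<^sup>+z. f (rot 0 1 (rot 0 1 z)) \<partial>lborel)"
      using True \<open>s = 0\<close> by (simp add: rot_def)
    also have "\<dots> = (\<integral>\<^sup>+z. f (rot 0 1 z) \<partial>lborel)"
      by (rule generic[of 0 1 "\<lambda>z. f (rot 0 1 z)"]) auto
    also have "\<dots> = (\<integral>\<^sup>+z. f z \<partial>lborel)" by (rule generic) auto
    finally show ?thesis .
  qed (rule generic; use cs in auto)
qed

text \<open>Explicit partial derivatives let the Laplacian be handled as a formula. The mixed ones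
  are separate arguments because they arise as different expressions, in T (D a) and in D (T
  a).\<close>

definition C2_derivs :: "(real \<times> real \<Rightarrow> real) \<Rightarrow> (real \<times> real \<Rightarrow> real) \<Rightarrow> (real \<times> real \<Rightarrow> real) \<Rightarrow>
    (real \<times> real \<Rightarrow> real) \<Rightarrow> (real \<times> real \<Rightarrow> real) \<Rightarrow> (real \<times> real \<Rightarrow> real) \<Rightarrow> (real \<times> real \<Rightarrow> real) \<Rightarrow> bool" where
  "C2_derivs F Fx Fy Fxx Fxy Fyx Fyy \<longleftrightarrow>
     (\<forall>z. (F has_derivative (\<lambda>h. fst h *\<^sub>R Fx z + snd h *\<^sub>R Fy z)) (at z)) \<and>
     (\<forall>z. (Fx has_derivative (\<lambda>h. fst h *\<^sub>R Fxx z + snd h *\<^sub>R Fxy z)) (at z)) \<and>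
     (\<forall>z. (Fy has_derivative (\<lambda>h. fst h *\<^sub>R Fyx z + snd h *\<^sub>R Fyy z)) (at z)) \<and>
     continuous_on UNIV Fxx \<and> continuous_on UNIV Fxy \<and> continuous_on UNIV Fyx \<and> continuous_on UNIV Fyy"

lemma C2_derivs_add:
  assumes "C2_derivs F Fx Fy Fxx Fxy Fyx Fyy" "C2_derivs G Gx Gy Gxx Gxy Gyx Gyy"
  shows "C2_derivs (\<lambda>z. F z + G z) (\<lambda>z. Fx z + Gx z) (\<lambda>z. Fy z + Gy z) (\<lambda>z. Fxx z + Gxx z)
    (\<lambda>z. Fxy z + Gxy z) (\<lambda>z. Fyx z + Gyx z) (\<lambda>z. Fyy z + Gyy z)"
proof -
  have *: "((\<lambda>z. f z + g z) has_derivative (\<lambda>h. fst h *\<^sub>R (a + a') + snd h *\<^sub>R (b + b'))) (at z)"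
    if "(f has_derivative (\<lambda>h. fst h *\<^sub>R a + snd h *\<^sub>R b)) (at z)"
       "(g has_derivative (\<lambda>h. fst h *\<^sub>R a' + snd h *\<^sub>R b')) (at z)"
    for f g :: "real \<times> real \<Rightarrow> real" and a b a' b' z
    by (rule has_derivative_eq_rhs[OF has_derivative_add[OF that]]) (auto simp: algebra_simps)
  show ?thesis
    using assms unfolding C2_derivs_def by (intro conjI allI * continuous_on_add) blast+
qed

text \<open>The Laplacian is 4 k, so adding this function makes any function with Laplacian at least
  -4 k subharmonic.\<close>

lemma C2_derivs_dist_square:
  "C2_derivs (\<lambda>z. k * (norm (z - w))\<^sup>2) (\<lambda>z. 2 * k * (fst z - fst w)) (\<lambda>z. 2 * k * (snd z - snd w))
    (\<lambda>z. 2 * k) (\<lambda>z. 0) (\<lambda>z. 0) (\<lambda>z. 2 * k)"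
proof -
  have n: "(norm (z - w))\<^sup>2 = (fst z - fst w)\<^sup>2 + (snd z - snd w)\<^sup>2" for z
    by (simp add: norm_prod_def)
  show ?thesis
    unfolding C2_derivs_def n
    by (auto intro!: derivative_eq_intros simp: algebra_simps)
qed

lemma has_real_derivative_along:
  fixes F :: "real \<times> real \<Rightarrow> real"
  assumes "(F has_derivative (\<lambda>h. fst h *\<^sub>R a + snd h *\<^sub>R b)) (at (p x))"
    and "(p has_vector_derivative v) (at x within S)"
  shows "((\<lambda>x. F (p x)) has_real_derivative fst v * a + snd v * b) (at x within S)"
  using vector_derivative_diff_chain_within[OF assms(2) has_derivative_at_withinI[OF assms(1)]]
  by (simp add: o_def has_real_derivative_iff_has_vector_derivative)

lemma continuous_on_C2_derivs:
  assumes "C2_derivs F Fx Fy Fxx Fxy Fyx Fyy"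
  shows "continuous_on S F" "continuous_on S Fx" "continuous_on S Fy"
    "continuous_on S Fxx" "continuous_on S Fxy" "continuous_on S Fyx" "continuous_on S Fyy"
  using assms unfolding C2_derivs_def
  by (meson continuous_on_subset has_derivative_continuous continuous_at_imp_continuous_on subset_UNIV)+

text \<open>With \<open>p = r \<cdot> rot s z\<close> and \<open>\<psi>(r)\<close> the derivative of the circular mean, Green's formula reads
  \<open>(r \<psi>)' = r \<integral> |z|\<^sup>2 \<Delta>F\<close>: the \<open>s\<close>-derivative of the tangential component of the gradient integrates to zero.\<close>

lemma sub_mean_value_circle:
  assumes F: "C2_derivs F Fx Fy Fxx Fxy Fyx Fyy"
    and lap: "\<And>z. z \<in> cball w (norm z0) \<Longrightarrow> Fxx z + Fyy z \<ge> 0"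
  shows "2 * pi * F w \<le> integral {0..2*pi} (\<lambda>s. F (w + rot (cos s) (sin s) z0))"
proof -
  obtain x y where z0: "z0 = (x, y)" by fastforce
  define c where "c s = cos s * x - sin s * y" for s
  define d where "d s = sin s * x + cos s * y" for s
  define p where "p r s = w + (r * c s, r * d s)" for r s
  note dF = F[unfolded C2_derivs_def, THEN conjunct1, rule_format]
  note dFx = F[unfolded C2_derivs_def, THEN conjunct2, THEN conjunct1, rule_format]
  note dFy = F[unfolded C2_derivs_def, THEN conjunct2, THEN conjunct2, THEN conjunct1, rule_format]
  have cd [continuous_intros]: "continuous_on S (\<lambda>x. c (f x))" "continuous_on S (\<lambda>x. d (f x))"
    if "continuous_on S f" for S and f :: "real \<times> real \<Rightarrow> real"
    unfolding c_def d_def by (intro continuous_intros that)+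
  have cd1 [continuous_intros]: "continuous_on S c" "continuous_on S d" for S
    unfolding c_def d_def by (intro continuous_intros)+
  have cp: "continuous_on S (\<lambda>q. p (fst q) (snd q))" for S
    unfolding p_def by (intro continuous_intros)
  have cps: "continuous_on S (p r)" for S r
    unfolding p_def by (intro continuous_intros)
  have comp [continuous_intros]: "continuous_on S (\<lambda>q. G (p (fst q) (snd q)))" "continuous_on T (\<lambda>s. G (p r s))"
    if "continuous_on UNIV G" for G :: "real \<times> real \<Rightarrow> real" and S T r
    using continuous_on_compose2[OF that cp] continuous_on_compose2[OF that cps] by auto
  note cont = continuous_on_C2_derivs[OF F, of UNIV]
  have c': "(c has_real_derivative - d s) (at s within S)" for s S
    unfolding c_def d_def by (auto intro!: derivative_eq_intros)
  have d': "(d has_real_derivative c s) (at s within S)" for s S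
    unfolding c_def d_def by (auto intro!: derivative_eq_intros)
  have pr: "((\<lambda>r. p r s) has_vector_derivative (c s, d s)) (at r within S)" for r s S
    unfolding p_def has_vector_derivative_def
    by (auto intro!: derivative_eq_intros simp: algebra_simps)
  have ps: "(p r has_vector_derivative (r * - d s, r * c s)) (at s within S)" for r s S
  proof -
    have "((\<lambda>s. (r * c s, r * d s)) has_vector_derivative (r * - d s, r * c s)) (at s within S)"
      by (intro has_vector_derivative_Pair DERIV_cmult[OF c', THEN has_real_derivative_iff_has_vector_derivative[THEN iffD1]]
          DERIV_cmult[OF d', THEN has_real_derivative_iff_has_vector_derivative[THEN iffD1]])
    then show ?thesis unfolding p_def using has_vector_derivative_add[OF has_vector_derivative_const] by fastforce
  qed
  define G where "G r s = c s * Fx (p r s) + d s * Fy (p r s)" for r s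
  define G' where "G' r s = c s * (c s * Fxx (p r s) + d s * Fxy (p r s)) +
      d s * (c s * Fyx (p r s) + d s * Fyy (p r s))" for r s
  define \<phi> where "\<phi> r = integral {0..2*pi} (\<lambda>s. F (p r s))" for r
  define \<psi> where "\<psi> r = integral {0..2*pi} (G r)" for r
  have intble: "G r integrable_on {0..2*pi}" "G' r integrable_on {0..2*pi}"
      "(\<lambda>s. F (p r s)) integrable_on {0..2*pi}" for r
    unfolding G_def G'_def by (intro integrable_continuous_interval continuous_intros cont)+
  have \<phi>': "(\<phi> has_real_derivative \<psi> r) (at r)" for r
    unfolding \<phi>_def \<psi>_def box_real(2)[symmetric]
  proof (rule leibniz_rule_field_derivative[where U = UNIV, simplified])
    show "((\<lambda>r. F (p r s)) has_real_derivative G r s) (at r)" for r s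
      using has_real_derivative_along[OF dF pr, of s r UNIV] by (simp add: G_def)
    show "continuous_on (UNIV \<times> cbox 0 (2*pi)) (\<lambda>(r, s). G r s)"
      unfolding G_def split_def by (intro continuous_intros cont)
  qed (use intble in auto)
  have \<psi>': "(\<psi> has_real_derivative integral {0..2*pi} (G' r)) (at r)" for r
    unfolding \<psi>_def box_real(2)[symmetric]
  proof (rule leibniz_rule_field_derivative[where U = UNIV, simplified])
    show "((\<lambda>r. G r s) has_real_derivative G' r s) (at r)" for r s
      unfolding G_def
      by (rule DERIV_cong[OF DERIV_add[OF DERIV_cmult[OF has_real_derivative_along[OF dFx pr]]
              DERIV_cmult[OF has_real_derivative_along[OF dFy pr]]]]) (simp add: G'_def)
    show "continuous_on (UNIV \<times> cbox 0 (2*pi)) (\<lambda>(r, s). G' r s)"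
      unfolding G'_def split_def by (intro continuous_intros cont)
  qed (use intble in auto)
  have green: "\<psi> r + r * integral {0..2*pi} (G' r) \<ge> 0" if r: "0 \<le> r" "r \<le> 1" for r
  proof -
    \<comment> \<open>The tangential component of the gradient on the circle. In T' + G + r G' the
      first derivatives of F and the mixed ones cancel, leaving r (c^2 + d^2) times the
      Laplacian.\<close>
    define T where "T s = - d s * Fx (p r s) + c s * Fy (p r s)" for s
    define T' where "T' s = - d s * (r * - d s * Fxx (p r s) + r * c s * Fxy (p r s)) - c s * Fx (p r s)
      + (c s * (r * - d s * Fyx (p r s) + r * c s * Fyy (p r s)) - d s * Fy (p r s))" for s
    have "(T has_vector_derivative T' s) (at s within {0..2*pi})" for s
      unfolding T_def has_real_derivative_iff_has_vector_derivative[symmetric]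
      by (rule DERIV_cong[OF DERIV_add[OF DERIV_mult[OF DERIV_minus[OF d'] has_real_derivative_along[OF dFx ps]]
              DERIV_mult[OF c' has_real_derivative_along[OF dFy ps]]]]) (simp add: T'_def algebra_simps)
    then have "(T' has_integral T (2*pi) - T 0) {0..2*pi}"
      by (intro fundamental_theorem_of_calculus) auto
    moreover have "T (2*pi) = T 0" by (simp add: T_def p_def c_def d_def)
    ultimately have "(T' has_integral 0) {0..2*pi}" by simp
    from has_integral_add[OF this has_integral_add[OF integrable_integral[OF intble(1)[of r]]
          has_integral_mult_right[OF integrable_integral[OF intble(2)[of r]], of r]]]
    have "((\<lambda>s. T' s + (G r s + r * G' r s)) has_integral \<psi> r + r * integral {0..2*pi} (G' r)) {0..2*pi}"
      by (simp add: \<psi>_def)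
    then show ?thesis
    proof (rule has_integral_nonneg)
      fix s
      have "T' s + (G r s + r * G' r s) = r * (((c s)\<^sup>2 + (d s)\<^sup>2) * (Fxx (p r s) + Fyy (p r s)))"
        unfolding T'_def G_def G'_def by (simp add: power2_eq_square algebra_simps)
      moreover have "p r s \<in> cball w (norm z0)"
      proof -
        have "dist w (p r s) = norm (r *\<^sub>R rot (cos s) (sin s) z0)"
          by (subst dist_commute) (simp add: p_def dist_norm c_def d_def rot_def z0)
        also have "\<dots> = \<bar>r\<bar> * norm z0" using norm_rot[of "cos s" "sin s" z0] by simp
        also have "\<dots> \<le> norm z0" using r by (simp add: mult_left_le_one_le)
        finally show ?thesis by simp
      qed
      ultimately show "0 \<le> T' s + (G r s + r * G' r s)" using lap r by simp
    qed
  qed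
  have \<psi>_nonneg: "\<psi> r \<ge> 0" if r: "0 < r" "r \<le> 1" for r
  proof -
    \<comment> \<open>The function r \<psi> r starts at 0 and is nondecreasing by
      \<open>green\<close>; the sign of \<psi> follows on dividing by r > 0.\<close>
    have "0 * \<psi> 0 \<le> r * \<psi> r"
    proof (rule DERIV_nonneg_imp_nondecreasing[where f = "\<lambda>r. r * \<psi> r"])
      fix t assume t: "0 \<le> t" "t \<le> r"
      have "((\<lambda>r. r * \<psi> r) has_real_derivative \<psi> t + t * integral {0..2*pi} (G' t)) (at t)"
        by (rule DERIV_cong[OF DERIV_mult[OF DERIV_ident \<psi>']]) simp
      then show "\<exists>D. ((\<lambda>r. r * \<psi> r) has_real_derivative D) (at t) \<and> 0 \<le> D"
        using green[of t] t r by auto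
    qed (use r in auto)
    then show ?thesis using r by (simp add: zero_le_mult_iff)
  qed
  have "\<phi> 0 \<le> \<phi> 1"
  proof (rule DERIV_nonneg_imp_increasing_open[where f = \<phi>])
    show "continuous_on {0..1} \<phi>"
      using \<phi>' by (meson DERIV_continuous continuous_at_imp_continuous_on)
    show "\<exists>D. (\<phi> has_real_derivative D) (at r) \<and> 0 \<le> D" if "0 < r" "r < 1" for r
      using \<phi>'[of r] \<psi>_nonneg[of r] that by auto
  qed auto
  moreover have "\<phi> 0 = 2 * pi * F w" by (simp add: \<phi>_def p_def flip: zero_prod_def)
  moreover have "w + rot (cos s) (sin s) z0 = p 1 s" for s by (simp add: p_def c_def d_def rot_def z0)
  ultimately show ?thesis by (simp add: \<phi>_def)
qed

text \<open>The circle inequality is integrated over the disc. Rotating H does not change its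
  integral, so Tonelli together with rotation invariance takes the place of polar
  coordinates.\<close>

lemma sub_mean_value_disc:
  assumes F: "C2_derivs F Fx Fy Fxx Fxy Fyx Fyy" and F0: "\<And>z. F z \<ge> 0"
    and lap: "\<And>z. z \<in> ball w R \<Longrightarrow> Fxx z + Fyy z \<ge> 0"
  shows "ennreal (F w) * emeasure lborel (ball w R) \<le> (\<integral>\<^sup>+z\<in>ball w R. ennreal (F z) \<partial>lborel)"
proof -
  have cF: "continuous_on UNIV F" using continuous_on_C2_derivs[OF F] by blast
  then have mF [measurable]: "F \<in> borel_measurable borel" by (rule borel_measurable_continuous_onI)
  define H where "H z = ennreal (F (w + z)) * indicator (ball 0 R) z" for z
  have [measurable]: "ball x R \<in> sets borel" for x :: "real \<times> real"
    by (rule borel_open[OF open_ball])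
  have [measurable]: "H \<in> borel_measurable borel" unfolding H_def by measurable
  have shift: "(\<integral>\<^sup>+z\<in>ball w R. ennreal (F z) \<partial>lborel) = (\<integral>\<^sup>+z. H z \<partial>lborel)"
  proof -
    have "(\<integral>\<^sup>+z\<in>ball w R. ennreal (F z) \<partial>lborel) =
        (\<integral>\<^sup>+z. ennreal (F z) * indicator (ball w R) z \<partial>(distr lborel borel ((+) w)))"
      by (simp add: lborel_distr_plus)
    also have "\<dots> = (\<integral>\<^sup>+z. ennreal (F (w + z)) * indicator (ball w R) (w + z) \<partial>lborel)"
      by (rule nn_integral_distr) auto
    also have "\<dots> = (\<integral>\<^sup>+z. H z \<partial>lborel)"
      by (intro nn_integral_cong) (simp add: H_def indicator_def dist_norm)
    finally show ?thesis .
  qed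
  have Hrot: "H (rot (cos s) (sin s) z) = ennreal (F (w + rot (cos s) (sin s) z)) * indicator (ball 0 R) z" for s z
    by (simp add: H_def indicator_def norm_rot)
  have rotcont: "continuous_on UNIV (\<lambda>q::real \<times> (real \<times> real). rot (cos (fst q)) (sin (fst q)) (snd q))"
    unfolding rot_def by (intro continuous_intros)
  \<comment> \<open>The indicator turns the average over angles into an integral over the whole
    line, to which Tonelli applies.\<close>
  define Q where "Q s z = H (rot (cos s) (sin s) z) * indicator {0..2*pi} s" for s z
  have mQ: "case_prod Q \<in> borel_measurable (lborel \<Otimes>\<^sub>M lborel)"
  proof -
    have "(\<lambda>q::real \<times> (real \<times> real). H (rot (cos (fst q)) (sin (fst q)) (snd q))) \<in> borel_measurable borel"
      by (rule measurable_compose[OF borel_measurable_continuous_onI[OF rotcont]]) measurable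
    then have "(\<lambda>q::real \<times> (real \<times> real). H (rot (cos (fst q)) (sin (fst q)) (snd q)) * indicator {0..2*pi} (fst q))
        \<in> borel_measurable borel"
      by (intro borel_measurable_times_ennreal) (auto simp: borel_prod[symmetric])
    then show ?thesis unfolding Q_def by (simp add: lborel_prod split_def)
  qed
  have inner: "(\<integral>\<^sup>+s. Q s z \<partial>lborel) \<ge> ennreal (2 * pi) * (ennreal (F w) * indicator (ball w R) (w + z))" for z
  proof (cases "norm z < R")
    case True
    let ?f = "\<lambda>s. F (w + rot (cos s) (sin s) z)"
    have "continuous_on {0..2*pi} ?f"
      unfolding rot_def by (rule continuous_on_compose2[OF cF]) (auto intro!: continuous_intros)
    then have "(?f has_integral integral {0..2*pi} ?f) {0..2*pi}"
      by (intro integrable_integral integrable_continuous_interval)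
    then have "(\<integral>\<^sup>+s. ennreal (?f s) * indicator {0..2*pi} s \<partial>lborel) = ennreal (integral {0..2*pi} ?f)"
      using F0 by (rule nn_integral_has_integral_lebesgue'[rotated])
    then have "(\<integral>\<^sup>+s. Q s z \<partial>lborel) = ennreal (integral {0..2*pi} ?f)"
      using True by (simp add: Q_def Hrot)
    also have "\<dots> \<ge> ennreal (2 * pi * F w)"
      by (intro ennreal_leI sub_mean_value_circle[OF F] lap) (use True in auto)
    finally show ?thesis using True F0 by (simp add: ennreal_mult dist_norm mult_ac)
  qed (simp add: dist_norm)
  have "ennreal (2 * pi) * (ennreal (F w) * emeasure lborel (ball w R)) =
      (\<integral>\<^sup>+z. ennreal (2 * pi) * (ennreal (F w) * indicator (ball w R) z) \<partial>lborel)"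
    by (simp add: nn_integral_cmult)
  also have "\<dots> = (\<integral>\<^sup>+z. ennreal (2 * pi) * (ennreal (F w) * indicator (ball w R) z) \<partial>(distr lborel borel ((+) w)))"
    by (simp add: lborel_distr_plus)
  also have "\<dots> = (\<integral>\<^sup>+z. ennreal (2 * pi) * (ennreal (F w) * indicator (ball w R) (w + z)) \<partial>lborel)"
    by (rule nn_integral_distr) auto
  also have "\<dots> \<le> (\<integral>\<^sup>+z. (\<integral>\<^sup>+s. Q s z \<partial>lborel) \<partial>lborel)"
    by (intro nn_integral_mono inner)
  also have "\<dots> = (\<integral>\<^sup>+s. (\<integral>\<^sup>+z. Q s z \<partial>lborel) \<partial>lborel)"
    by (rule lborel_pair.Fubini'[OF mQ])
  also have "\<dots> = (\<integral>\<^sup>+s. (\<integral>\<^sup>+z. H z \<partial>lborel) * indicator {0..2*pi} s \<partial>(lborel :: real measure))"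
  proof (rule nn_integral_cong)
    fix s :: real
    have "(\<integral>\<^sup>+z. Q s z \<partial>lborel) = (\<integral>\<^sup>+z. H (rot (cos s) (sin s) z) \<partial>lborel) * indicator {0..2*pi} s"
      unfolding Q_def by (rule nn_integral_multc) auto
    then show "(\<integral>\<^sup>+z. Q s z \<partial>lborel) = (\<integral>\<^sup>+z. H z \<partial>lborel) * indicator {0..2*pi} s"
      by (simp add: nn_integral_rot)
  qed
  also have "\<dots> = ennreal (2 * pi) * (\<integral>\<^sup>+z. H z \<partial>lborel)"
    by (simp add: nn_integral_cmult mult.commute)
  finally have le: "ennreal (2 * pi) * (ennreal (F w) * emeasure lborel (ball w R)) \<le> ennreal (2 * pi) * (\<integral>\<^sup>+z. H z \<partial>lborel)" .
  then show ?thesis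
    unfolding shift by (subst (asm) ennreal_mult_le_mult_iff) auto
qed

text \<open>The weight (1 - |z - z0|)^2 selects a point z1, with value e1 = e z1, such that e <= 4
  e1 on the disc of radius \<rho> about z1. There e + k |z - z1|^2 is subharmonic, and the mean
  value inequality gives e1 pi r^2 <= E + k r^2 pi r^2 for r <= \<rho>. Smallness of E rules out
  that e1 \<rho>^2 is large.\<close>

lemma heinz_estimate:
  fixes e :: "real \<times> real \<Rightarrow> real"
  assumes e: "C2_derivs e ex ey exx exy eyx eyy" and e0: "\<And>z. e z \<ge> 0" and K: "K > 0"
    and lap: "\<And>z. exx z + eyy z \<ge> - K * (e z)\<^sup>2"
    and int: "(\<integral>\<^sup>+z\<in>ball z0 1. ennreal (e z) \<partial>lborel) \<le> ennreal E" and E: "0 \<le> E" "16 * K * E < pi"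
  shows "e z0 \<le> 4 * E"
proof -
  have ce: "continuous_on S e" for S using continuous_on_C2_derivs[OF e] by blast
  have me [measurable]: "e \<in> borel_measurable borel" by (rule borel_measurable_continuous_onI[OF ce])
  have [measurable]: "ball x r \<in> sets borel" for x :: "real \<times> real" and r
    by (rule borel_open[OF open_ball])
  define g where "g z = (1 - dist z0 z)\<^sup>2 * e z" for z
  have "continuous_on (cball z0 1) g" unfolding g_def by (intro continuous_intros ce)
  then obtain z1 where z1: "z1 \<in> cball z0 1" "\<And>z. z \<in> cball z0 1 \<Longrightarrow> g z \<le> g z1"
    using continuous_attains_sup[OF compact_cball, of z0 1 g] by auto
  define \<rho> where "\<rho> = (1 - dist z0 z1) / 2"
  have \<rho>: "0 \<le> \<rho>" "2 * \<rho> = 1 - dist z0 z1" using z1(1) by (auto simp: \<rho>_def)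
  define e1 where "e1 = e z1"
  have e1: "0 \<le> e1" using e0 by (simp add: e1_def)
  have start: "e z0 \<le> 4 * \<rho>\<^sup>2 * e1"
    using z1(2)[of z0] by (simp add: g_def e1_def power_mult_distrib flip: \<rho>(2))
  show ?thesis
  proof (cases "\<rho> = 0 \<or> e1 = 0")
    case True
    then show ?thesis using start E by auto
  next
    case False
    then have pos: "\<rho> > 0" "e1 > 0" using \<rho>(1) e1 by auto
    have near: "e z \<le> 4 * e1" "z \<in> ball z0 1" if z: "z \<in> ball z1 \<rho>" for z
    proof -
      have "dist z0 z \<le> dist z0 z1 + dist z1 z" by (rule dist_triangle)
      then have d: "\<rho> \<le> 1 - dist z0 z" using z \<rho>(2) by simp
      then show "z \<in> ball z0 1" using pos by simp
      then have "g z \<le> g z1" using z1(2) by simp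
      then have "(1 - dist z0 z)\<^sup>2 * e z \<le> \<rho>\<^sup>2 * (4 * e1)"
        by (simp add: g_def e1_def power_mult_distrib mult_ac flip: \<rho>(2))
      moreover have "\<rho>\<^sup>2 * e z \<le> (1 - dist z0 z)\<^sup>2 * e z"
        using d \<rho>(1) e0 by (intro mult_right_mono power_mono) auto
      ultimately have "\<rho>\<^sup>2 * e z \<le> \<rho>\<^sup>2 * (4 * e1)" by simp
      then show "e z \<le> 4 * e1" using pos by simp
    qed
    \<comment> \<open>Chosen so that 4 k = K (4 e1)^2 cancels the lower bound for the Laplacian of e
      on the small disc.\<close>
    define k where "k = 4 * K * e1\<^sup>2"
    have k: "k \<ge> 0" using K by (simp add: k_def)
    note F = C2_derivs_add[OF e C2_derivs_dist_square[of k z1]]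
    have main: "e1 * (pi * r\<^sup>2) \<le> E + k * r\<^sup>2 * (pi * r\<^sup>2)" if r: "0 < r" "r \<le> \<rho>" for r
    proof -
      have em: "emeasure lborel (ball z1 r) = ennreal (pi * r\<^sup>2)"
        using r by (subst emeasure_ball) (auto simp: unit_ball_vol_2 power2_eq_square)
      have sub: "ball z1 r \<subseteq> ball z1 \<rho>" using r by auto
      have "ennreal (e z1 + k * (norm (z1 - z1))\<^sup>2) * emeasure lborel (ball z1 r) \<le>
          (\<integral>\<^sup>+z\<in>ball z1 r. ennreal (e z + k * (norm (z - z1))\<^sup>2) \<partial>lborel)"
      proof (rule sub_mean_value_disc[OF F])
        fix z assume "z \<in> ball z1 r"
        then have "z \<in> ball z1 \<rho>" using sub by blast
        then have "(e z)\<^sup>2 \<le> (4 * e1)\<^sup>2" using near(1) e0 by (intro power_mono) auto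
        then have "K * (e z)\<^sup>2 \<le> K * (4 * e1)\<^sup>2" using K by (intro mult_left_mono) auto
        then show "0 \<le> exx z + 2 * k + (eyy z + 2 * k)"
          using lap[of z] by (simp add: k_def power_mult_distrib)
      qed (use e0 k in auto)
      also have "\<dots> \<le> (\<integral>\<^sup>+z. ennreal (e z) * indicator (ball z0 1) z + ennreal (k * r\<^sup>2) * indicator (ball z1 r) z \<partial>lborel)"
      proof (intro nn_integral_mono)
        fix z
        have "k * (norm (z - z1))\<^sup>2 \<le> k * r\<^sup>2" if "z \<in> ball z1 r"
          using that k by (intro mult_left_mono power_mono) (auto simp: dist_norm norm_minus_commute)
        then have "ennreal (e z + k * (norm (z - z1))\<^sup>2) \<le> ennreal (e z) + ennreal (k * r\<^sup>2)" if "z \<in> ball z1 r"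
          using that e0 k by (subst ennreal_plus[symmetric]) (auto intro!: ennreal_leI)
        moreover have "z \<in> ball z0 1" if "z \<in> ball z1 r" using near(2) that sub by blast
        ultimately show "ennreal (e z + k * (norm (z - z1))\<^sup>2) * indicator (ball z1 r) z \<le>
            ennreal (e z) * indicator (ball z0 1) z + ennreal (k * r\<^sup>2) * indicator (ball z1 r) z"
          by (auto simp: indicator_def)
      qed
      also have "\<dots> = (\<integral>\<^sup>+z\<in>ball z0 1. ennreal (e z) \<partial>lborel) + ennreal (k * r\<^sup>2) * emeasure lborel (ball z1 r)"
        by (subst nn_integral_add) (auto simp: nn_integral_cmult)
      also have "\<dots> \<le> ennreal E + ennreal (k * r\<^sup>2) * emeasure lborel (ball z1 r)"
        by (intro add_right_mono int)
      finally have "ennreal (e1 * (pi * r\<^sup>2)) \<le> ennreal (E + k * r\<^sup>2 * (pi * r\<^sup>2))"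
        using e1 k E by (simp add: em e1_def ennreal_mult ennreal_plus)
      then show ?thesis
        by (subst (asm) ennreal_le_iff) (use k E in auto)
    qed
    \<comment> \<open>Once 8 K e1 r^2 <= 1, the correction term is at most half of the left-hand
      side.\<close>
    have half: "e1 * (pi * r\<^sup>2) \<le> 2 * E" if r: "0 < r" "r \<le> \<rho>" "8 * K * e1 * r\<^sup>2 \<le> 1" for r
    proof -
      have "k * r\<^sup>2 * (pi * r\<^sup>2) = (8 * K * e1 * r\<^sup>2) * (e1 * (pi * r\<^sup>2)) / 2"
        by (simp add: k_def power2_eq_square)
      also have "\<dots> \<le> 1 * (e1 * (pi * r\<^sup>2)) / 2"
        using r pos by (intro divide_right_mono mult_right_mono) auto
      finally show ?thesis using main[OF r(1,2)] by simp
    qed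
    have "8 * K * e1 * \<rho>\<^sup>2 \<le> 1"
    proof (rule ccontr)
      assume neg: "\<not> 8 * K * e1 * \<rho>\<^sup>2 \<le> 1"
      \<comment> \<open>The radius with 8 K e1 r^2 = 1. Under the assumption it is at most \<rho>,
        and \<open>half\<close> then reads pi / (8 K) <= 2 E, contrary to the smallness of
        E.\<close>
      define r where "r = sqrt (1 / (8 * K * e1))"
      have q: "8 * K * e1 > 0" using K pos by simp
      have r2: "r\<^sup>2 = 1 / (8 * K * e1)" using q by (simp add: r_def)
      have r0: "r > 0" using q by (simp add: r_def)
      have "r\<^sup>2 \<le> \<rho>\<^sup>2" using neg q by (simp add: r2 pos_divide_le_eq mult.commute)
      then have "r \<le> \<rho>" using \<rho>(1) by (rule power2_le_imp_le)
      then have "e1 * (pi * r\<^sup>2) \<le> 2 * E" using r0 q by (intro half) (auto simp: r2)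
      then have "pi / (8 * K) \<le> 2 * E" using pos by (simp add: r2)
      then have "pi \<le> 16 * K * E" using K by (simp add: field_simps)
      then show False using E by simp
    qed
    then have "e1 * (pi * \<rho>\<^sup>2) \<le> 2 * E" using half pos by simp
    moreover have "e1 * (2 * \<rho>\<^sup>2) \<le> e1 * (pi * \<rho>\<^sup>2)"
      using pos pi_ge_two by (intro mult_left_mono mult_right_mono) auto
    ultimately have "2 * (\<rho>\<^sup>2 * e1) \<le> 2 * E" by (simp add: mult_ac)
    then show ?thesis using start by simp
  qed
qed

section \<open>Twisted derivatives\<close>

text \<open>f is convex, its second derivative being at least c f >= 0. A convex function with a
  nonzero slope somewhere is unbounded on one side; so f is constant, and then c f <= 0.\<close>

lemma bounded_subsolution_zero:
  fixes f f1 f2 :: "real \<Rightarrow> real"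
  assumes f: "\<And>t. (f has_real_derivative f1 t) (at t)" and f1: "\<And>t. (f1 has_real_derivative f2 t) (at t)"
    and ineq: "\<And>t. f2 t \<ge> c * f t" and c: "c > 0" and f0: "\<And>t. f t \<ge> 0" and B: "\<And>t. f t \<le> B"
  shows "f t = 0"
proof -
  have mono: "f1 s \<le> f1 t" if "s \<le> t" for s t
    by (rule DERIV_nonneg_imp_nondecreasing[where f = f1, OF that])
      (use f1 ineq c f0 in \<open>meson mult_nonneg_nonneg order_less_imp_le order_trans\<close>)
  have "f1 t = 0" for t
  proof (rule ccontr)
    assume "f1 t \<noteq> 0"
    \<comment> \<open>Over this length the slope \<open>f1 t\<close> would change f by B + 1, while
      f stays between 0 and B.\<close>
    define h where "h = (B + 1) / \<bar>f1 t\<bar>"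
    have B0: "B \<ge> 0" using f0 B order_trans by blast
    have h: "h > 0" using B0 \<open>f1 t \<noteq> 0\<close> by (simp add: h_def)
    show False
    proof (cases "f1 t > 0")
      case True
      obtain z where z: "t < z" "z < t + h" "f (t + h) - f t = (t + h - t) * f1 z"
        using MVT2[of t "t + h" f f1] f h by auto
      have "h * f1 t \<le> h * f1 z" using mono[of t z] z h by (intro mult_left_mono) auto
      moreover have "h * f1 t = B + 1" using True by (simp add: h_def)
      ultimately show False using z(3) B[of "t + h"] f0[of t] by simp
    next
      case False
      obtain z where z: "t - h < z" "z < t" "f t - f (t - h) = (t - (t - h)) * f1 z"
        using MVT2[of "t - h" t f f1] f h by auto
      have "h * f1 z \<le> h * f1 t" using mono[of z t] z h by (intro mult_left_mono) auto
      moreover have "h * f1 t = - (B + 1)" using False \<open>f1 t \<noteq> 0\<close> by (simp add: h_def field_simps)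
      ultimately show False using z(3) B[of "t - h"] f0[of t] by simp
    qed
  qed
  then have "f1 = (\<lambda>_. 0)" by blast
  then have "f2 t = 0" using f1[of t] DERIV_unique[OF _ DERIV_const] by metis
  then have "c * f t \<le> 0" using ineq[of t] by simp
  then show ?thesis using c f0[of t] by (simp add: mult_le_0_iff)
qed

section \<open>Calculus of \<open>d_t\<close> and \<open>d_theta_alpha\<close>\<close>

lemma dderiv_add:
  assumes "smooth_on UNIV f" "smooth_on UNIV g"
  shows "dderiv v (\<lambda>z. f z + g z) z = dderiv v f z + dderiv v g z"
  by (rule dderiv_eq, intro has_derivative_add has_derivative_dderiv)
    (use assms smooth_on_differentiable_at in blast)+

lemma dderiv_matrix:
  fixes f :: "'a::real_normed_vector \<Rightarrow> real^'n"
  assumes "smooth_on UNIV f"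
  shows "dderiv v (\<lambda>z. A *v f z) z = A *v dderiv v f z"
  by (rule dderiv_eq, intro bounded_linear.has_derivative[OF matrix_vector_mul_bounded_linear] has_derivative_dderiv)
    (use assms smooth_on_differentiable_at in blast)

lemma smooth_on_add:
  fixes f g :: "'a::real_normed_vector \<Rightarrow> real^'n"
  shows "smooth_on UNIV f \<Longrightarrow> smooth_on UNIV g \<Longrightarrow> smooth_on UNIV (\<lambda>z. f z + g z)"
  using smooth_on_add_matrix[of f g "mat 1"] by simp

lemma smooth_on_matrix:
  fixes f :: "'a::real_normed_vector \<Rightarrow> real^'n" and A :: "real^'n^'n"
  shows "smooth_on UNIV f \<Longrightarrow> smooth_on UNIV (\<lambda>z. A *v f z)"
  using smooth_on_add_matrix[of f f "A - mat 1"] by (simp add: matrix_vector_mult_diff_rdistrib)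

lemma d_t_add:
  "smooth_on UNIV f \<Longrightarrow> smooth_on UNIV g \<Longrightarrow> d_t (\<lambda>z. f z + g z) z = d_t f z + d_t g z"
  unfolding d_t_def by (rule dderiv_add)

lemma d_theta_alpha_add:
  "smooth_on UNIV f \<Longrightarrow> smooth_on UNIV g \<Longrightarrow>
    d_theta_alpha \<alpha> (\<lambda>z. f z + g z) z = d_theta_alpha \<alpha> f z + d_theta_alpha \<alpha> g z"
  unfolding d_theta_alpha_def by (simp add: dderiv_add matrix_vector_right_distrib)

lemma d_t_d_theta_alpha_commute:
  fixes f :: "real \<times> real \<Rightarrow> real^'n"
  assumes "smooth_on UNIV f"
  shows "d_t (d_theta_alpha \<alpha> f) = d_theta_alpha \<alpha> (d_t f)"
proof
  fix z
  show "d_t (d_theta_alpha \<alpha> f) z = d_theta_alpha \<alpha> (d_t f) z"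
    unfolding d_t_def d_theta_alpha_def
    using assms by (simp add: dderiv_add dderiv_matrix smooth_on_dderiv smooth_on_matrix mixed_partials_commute)
qed

lemma dderiv_periodic:
  fixes f :: "real \<times> real \<Rightarrow> 'b::real_normed_vector"
  assumes f: "smooth_on UNIV f" and per: "\<And>t \<theta>. f (t, \<theta> + p) = f (t, \<theta>)"
  shows "dderiv v f (t, \<theta> + p) = dderiv v f (t, \<theta>)"
proof -
  have "(f has_derivative (\<lambda>v. dderiv v f (t, \<theta> + p))) (at ((t, \<theta>) + (0, p)))"
    using has_derivative_dderiv[OF smooth_on_differentiable_at[OF f open_UNIV UNIV_I]] by simp
  moreover have "((\<lambda>z. z + (0, p)) has_derivative (\<lambda>v. v)) (at (t, \<theta>))"
    by (auto intro!: derivative_eq_intros)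
  ultimately have "((\<lambda>z. f (z + (0, p))) has_derivative (\<lambda>v. dderiv v f (t, \<theta> + p))) (at (t, \<theta>))"
    using has_derivative_compose by blast
  moreover have "(\<lambda>z. f (z + (0, p))) = f" using per by auto
  ultimately show ?thesis using dderiv_eq by metis
qed

lemma periodic_reduce:
  fixes f :: "real \<times> real \<Rightarrow> 'b"
  assumes per: "\<And>t \<theta>. f (t, \<theta> + 2*pi) = f (t, \<theta>)"
  shows "f (t, \<theta> + 2 * pi * of_int k) = f (t, \<theta>)"
proof (induction k arbitrary: \<theta> rule: int_induct[of _ 0])
  case (step1 i)
  then show ?case using per[of t "\<theta> + 2 * pi * of_int i"] by (simp add: algebra_simps)
next
  case (step2 i)
  then show ?case using per[of t "\<theta> + 2 * pi * of_int (i - 1)"] by (simp add: algebra_simps)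
qed auto

lemma inner_twisted_has_derivative:
  fixes a b :: "real \<times> real \<Rightarrow> real^'n"
  assumes a: "smooth_on UNIV a" and b: "smooth_on UNIV b"
    and skew: "\<And>x y. (\<alpha> *v x) \<bullet> y = - (x \<bullet> (\<alpha> *v y))"
  shows "((\<lambda>z. a z \<bullet> b z) has_derivative (\<lambda>h. fst h *\<^sub>R (a z \<bullet> d_t b z + d_t a z \<bullet> b z) +
    snd h *\<^sub>R (a z \<bullet> d_theta_alpha \<alpha> b z + d_theta_alpha \<alpha> a z \<bullet> b z))) (at z)"
  by (rule has_derivative_eq_rhs[OF has_derivative_inner[OF smooth_has_derivative[OF a] smooth_has_derivative[OF b]]])
    (auto simp: d_t_def d_theta_alpha_def inner_simps skew algebra_simps)

text \<open>Expressed in T and D, the two pure second partials add up to 2 |T a|^2 + 2 |D a|^2 + 2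
  <a, T T a + D D a>, from which the Bochner formula is read off.\<close>

lemma C2_derivs_norm_square:
  fixes a :: "real \<times> real \<Rightarrow> real^'n"
  assumes a: "smooth_on UNIV a" and skew: "\<And>x y. (\<alpha> *v x) \<bullet> y = - (x \<bullet> (\<alpha> *v y))"
  defines "T \<equiv> d_t" and "D \<equiv> d_theta_alpha \<alpha>"
  shows "C2_derivs (\<lambda>z. a z \<bullet> a z) (\<lambda>z. a z \<bullet> T a z + T a z \<bullet> a z) (\<lambda>z. a z \<bullet> D a z + D a z \<bullet> a z)
    (\<lambda>z. (a z \<bullet> T (T a) z + T a z \<bullet> T a z) + (T a z \<bullet> T a z + T (T a) z \<bullet> a z))
    (\<lambda>z. (a z \<bullet> D (T a) z + D a z \<bullet> T a z) + (T a z \<bullet> D a z + D (T a) z \<bullet> a z))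
    (\<lambda>z. (a z \<bullet> T (D a) z + T a z \<bullet> D a z) + (D a z \<bullet> T a z + T (D a) z \<bullet> a z))
    (\<lambda>z. (a z \<bullet> D (D a) z + D a z \<bullet> D a z) + (D a z \<bullet> D a z + D (D a) z \<bullet> a z))"
proof -
  have sm: "smooth_on UNIV (T f)" "smooth_on UNIV (D f)" if "smooth_on UNIV f" for f
    unfolding T_def D_def using that by (auto intro: smooth_d_t smooth_d_theta_alpha)
  note s = a sm[OF a] sm[OF sm(1)[OF a]] sm[OF sm(2)[OF a]]
  note c = s[THEN smooth_on_continuous]
  have der: "((\<lambda>z. f z \<bullet> g z) has_derivative (\<lambda>h. fst h *\<^sub>R (f z \<bullet> T g z + T f z \<bullet> g z) +
      snd h *\<^sub>R (f z \<bullet> D g z + D f z \<bullet> g z))) (at z)"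
    if "smooth_on UNIV f" "smooth_on UNIV g" for f g :: "real \<times> real \<Rightarrow> real^'n" and z
    unfolding T_def D_def by (rule inner_twisted_has_derivative[OF that skew])
  have der2: "((\<lambda>z. f z \<bullet> g z + g z \<bullet> f z) has_derivative (\<lambda>h. fst h *\<^sub>R ((f z \<bullet> T g z + T f z \<bullet> g z) + (g z \<bullet> T f z + T g z \<bullet> f z)) +
      snd h *\<^sub>R ((f z \<bullet> D g z + D f z \<bullet> g z) + (g z \<bullet> D f z + D g z \<bullet> f z)))) (at z)"
    if "smooth_on UNIV f" "smooth_on UNIV g" for f g :: "real \<times> real \<Rightarrow> real^'n" and z
    by (rule has_derivative_eq_rhs[OF has_derivative_add[OF der[OF that] der[OF that(2,1)]]]) (auto simp: algebra_simps)
  show ?thesis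
    unfolding C2_derivs_def
    using der[OF s(1,1)] der2[OF s(1,2)] der2[OF s(1,3)]
    by (intro conjI allI continuous_intros c) auto
qed

text \<open>Serves to differentiate the orthogonality relations between \<tau> and the first
  derivatives of u.\<close>

lemma has_derivative_zero_parts:
  fixes f :: "real \<times> real \<Rightarrow> real"
  assumes "(f has_derivative (\<lambda>h. fst h *\<^sub>R a + snd h *\<^sub>R b)) (at z)" "\<And>z. f z = 0"
  shows "a = 0" "b = 0"
proof -
  have "f = (\<lambda>_. 0)" using assms(2) by blast
  then have "((\<lambda>_. 0) has_derivative (\<lambda>h. fst h *\<^sub>R a + snd h *\<^sub>R b)) (at z)" using assms(1) by simp
  then have "(\<lambda>h. fst h *\<^sub>R a + snd h *\<^sub>R b) = (\<lambda>h. 0)" using has_derivative_unique has_derivative_const by blast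
  then show "a = 0" "b = 0" by (auto dest: fun_cong[of _ _ "(1,0)"] fun_cong[of _ _ "(0,1)"])
qed

lemma has_vector_derivative_shift: "((\<lambda>s. c + s) has_vector_derivative 1) (at (s::real))"
  by (simp add: has_real_derivative_iff_has_vector_derivative[symmetric]) (auto intro!: derivative_eq_intros)

lemma twisted_curve_deriv:
  fixes g :: "real \<times> real \<Rightarrow> real^'n"
  assumes "smooth_on UNIV g"
  shows "((\<lambda>s. mexp (s *\<^sub>R \<alpha>) *v g (t, \<theta> + s)) has_vector_derivative
    mexp (s *\<^sub>R \<alpha>) *v d_theta_alpha \<alpha> g (t, \<theta> + s)) (at s)"
proof -
  have "((\<lambda>s. g (t, \<theta> + s)) has_vector_derivative dderiv (0, 1) g (t, \<theta> + s)) (at s)"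
    using vector_diff_chain_at[of "\<lambda>s. \<theta> + s" 1 s "\<lambda>x. g (t, x)", OF has_vector_derivative_shift smooth_slice_theta[OF assms]]
    by (simp add: o_def)
  from mexp_apply_deriv[OF this, of \<alpha>] show ?thesis
    by (simp add: d_theta_alpha_def add.commute)
qed

text \<open>Differentiation in s replaces g by \<open>d_theta_alpha \<alpha> g\<close>, so the
  curves of this form are a closed family for \<open>smooth_curveI\<close>.\<close>

lemma smooth_twisted_curve:
  fixes g :: "real \<times> real \<Rightarrow> real^'n"
  assumes "smooth_on UNIV g"
  shows "smooth_on UNIV (\<lambda>s. mexp (s *\<^sub>R \<alpha>) *v g (t, \<theta> + s))"
proof (rule smooth_curveI[where F = "{\<lambda>s. mexp (s *\<^sub>R \<alpha>) *v g (t, \<theta> + s) | g. smooth_on UNIV g}"])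
  fix f assume "f \<in> {\<lambda>s. mexp (s *\<^sub>R \<alpha>) *v g (t, \<theta> + s) | g. smooth_on UNIV g}"
  then obtain g where g: "f = (\<lambda>s. mexp (s *\<^sub>R \<alpha>) *v g (t, \<theta> + s))" "smooth_on UNIV g" by fast
  show "\<exists>g\<in>{\<lambda>s. mexp (s *\<^sub>R \<alpha>) *v g (t, \<theta> + s) | g. smooth_on UNIV g}. \<forall>s. (f has_vector_derivative g s) (at s)"
    unfolding g(1) using twisted_curve_deriv[OF g(2)] smooth_d_theta_alpha[OF g(2)]
    by (intro bexI[of _ "\<lambda>s. mexp (s *\<^sub>R \<alpha>) *v d_theta_alpha \<alpha> g (t, \<theta> + s)"]) fast+
qed (use assms in fast)

lemma time_curve_deriv:
  fixes g :: "real \<times> real \<Rightarrow> real^'n"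
  assumes "smooth_on UNIV g"
  shows "((\<lambda>s. g (t + s, \<theta>)) has_vector_derivative d_t g (t + s, \<theta>)) (at s)"
  unfolding d_t_def
  using vector_diff_chain_at[of "\<lambda>s. t + s" 1 s "\<lambda>x. g (x, \<theta>)", OF has_vector_derivative_shift smooth_slice_t[OF assms]]
  by (simp add: o_def)

lemma smooth_time_curve:
  fixes g :: "real \<times> real \<Rightarrow> real^'n"
  assumes "smooth_on UNIV g"
  shows "smooth_on UNIV (\<lambda>s. g (t + s, \<theta>))"
proof (rule smooth_curveI[where F = "{\<lambda>s. g (t + s, \<theta>) | g. smooth_on UNIV g}"])
  fix f :: "real \<Rightarrow> real^'n" assume "f \<in> {\<lambda>s. g (t + s, \<theta>) | g. smooth_on UNIV g}"
  then obtain g where g: "f = (\<lambda>s. g (t + s, \<theta>))" "smooth_on UNIV g" by fast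
  show "\<exists>g\<in>{\<lambda>s. g (t + s, \<theta>) | g. smooth_on UNIV g}. \<forall>s. (f has_vector_derivative g s) (at s)"
    unfolding g(1) using time_curve_deriv[OF g(2)] smooth_d_t[OF g(2)]
    by (intro bexI[of _ "\<lambda>s. d_t g (t + s, \<theta>)"]) fast+
qed (use assms in fast)

lemma tangent_spaceI:
  assumes "smooth_on UNIV \<gamma>" "\<And>s. \<gamma> s \<in> M" "\<gamma> 0 = p" "(\<gamma> has_vector_derivative v) (at 0)"
  shows "v \<in> tangent_space M p"
  using assms dderiv_vector_derivative[OF assms(4), of 1] unfolding tangent_space_def by auto

section \<open>Twisted harmonic maps of small energy\<close>

text \<open>Collects what depends on M and \<alpha> alone. The map u enters in the next locale, in
  accordance with \<epsilon> being chosen before u.\<close>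

locale twisted_setup =
  fixes M :: "(real^'n) set" and \<alpha> :: "real^'n^'n" and C :: real
  assumes orth: "\<And>s. orthogonal_matrix (mexp (s *\<^sub>R \<alpha>))"
    and act: "\<And>s p. p \<in> M \<Longrightarrow> mexp (s *\<^sub>R \<alpha>) *v p \<in> M"
    and C: "C > 0"
    and normal: "\<And>p q n. \<lbrakk>p \<in> M; q \<in> M; \<forall>v\<in>tangent_space M p. n \<bullet> v = 0\<rbrakk> \<Longrightarrow>
      (q - p) \<bullet> n \<le> C * (norm (q - p))\<^sup>2 * norm n"
begin

abbreviation "D \<equiv> d_theta_alpha \<alpha>"

lemmas skew = orthogonal_mexp_skew[OF orth]

end

locale twisted_map = twisted_setup M \<alpha> C
  for M :: "(real^'n) set" and \<alpha> :: "real^'n^'n" and C :: real +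
  fixes u :: "real \<times> real \<Rightarrow> real^'n"
  assumes u: "smooth_on UNIV u" and uM: "\<And>z. u z \<in> M"
    and uper: "\<And>t \<theta>. u (t, \<theta> + 2*pi) = u (t, \<theta>)"
    and harm: "twisted_harmonic M \<alpha> u"
begin

definition \<tau> where "\<tau> z = d_t (d_t u) z + D (D u) z"
definition e where "e z = d_t u z \<bullet> d_t u z + D u z \<bullet> D u z"

lemmas smooth_D = smooth_d_theta_alpha[of _ \<alpha>]

lemma smooth_Tu: "smooth_on UNIV (d_t u)" and smooth_Du: "smooth_on UNIV (D u)"
  using u by (auto intro: smooth_d_t smooth_D)

lemma smooth_\<tau>: "smooth_on UNIV \<tau>"
  unfolding \<tau>_def[abs_def] by (rule smooth_on_add[OF smooth_d_t[OF smooth_Tu] smooth_D[OF smooth_Du]])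

lemma \<tau>_normal: "v \<in> tangent_space M (u z) \<Longrightarrow> \<tau> z \<bullet> v = 0"
  using harm unfolding twisted_harmonic_def \<tau>_def by blast

lemma Tu_tangent: "d_t u (t, \<theta>) \<in> tangent_space M (u (t, \<theta>))"
  by (rule tangent_spaceI[where \<gamma> = "\<lambda>s. u (t + s, \<theta>)"])
    (use smooth_time_curve[OF u] uM time_curve_deriv[OF u, where t = t and \<theta> = \<theta> and s = 0] in auto)

lemma Du_tangent: "D u (t, \<theta>) \<in> tangent_space M (u (t, \<theta>))"
  by (rule tangent_spaceI[where \<gamma> = "\<lambda>s. mexp (s *\<^sub>R \<alpha>) *v u (t, \<theta> + s)"])
    (use smooth_twisted_curve[OF u] act[OF uM] twisted_curve_deriv[OF u, where t = t and \<theta> = \<theta> and s = 0 and \<alpha> = \<alpha>]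
      in \<open>auto simp: mexp_0\<close>)

lemma Tu_orth: "d_t u z \<bullet> \<tau> z = 0" and Du_orth: "D u z \<bullet> \<tau> z = 0"
  using \<tau>_normal[OF Tu_tangent[of "fst z" "snd z"]] \<tau>_normal[OF Du_tangent[of "fst z" "snd z"]]
  by (auto simp: inner_commute)

lemma TTu_bound: "d_t (d_t u) z \<bullet> \<tau> z \<le> 2 * C * (norm (d_t u z))\<^sup>2 * norm (\<tau> z)"
proof -
  obtain t \<theta> where z: "z = (t, \<theta>)" by fastforce
  have "d_t (d_t u) (t + 0, \<theta>) \<bullet> \<tau> z \<le> 2 * C * (norm (d_t u (t + 0, \<theta>)))\<^sup>2 * norm (\<tau> z)"
    by (rule normal_curvature_bound[of M "\<lambda>s. u (t + s, \<theta>)" "\<tau> z" C "\<lambda>s. d_t u (t + s, \<theta>)"])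
      (use normal[OF uM] uM \<tau>_normal time_curve_deriv[OF u] time_curve_deriv[OF smooth_Tu, where t = t and \<theta> = \<theta> and s = 0] Tu_orth z in auto)
  then show ?thesis by (simp add: z)
qed

text \<open>The factor |D u|^2 is kept instead of being enlarged to the energy density. In the
  equation for f it makes the error proportional to f itself.\<close>

lemma DDu_bound: "D (D u) z \<bullet> \<tau> z \<le> 2 * C * (norm (D u z))\<^sup>2 * norm (\<tau> z)"
proof -
  obtain t \<theta> where z: "z = (t, \<theta>)" by fastforce
  have "(mexp (0 *\<^sub>R \<alpha>) *v D (D u) (t, \<theta> + 0)) \<bullet> \<tau> z \<le>
      2 * C * (norm (mexp (0 *\<^sub>R \<alpha>) *v D u (t, \<theta> + 0)))\<^sup>2 * norm (\<tau> z)"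
    by (rule normal_curvature_bound[of M "\<lambda>s. mexp (s *\<^sub>R \<alpha>) *v u (t, \<theta> + s)" "\<tau> z" C
          "\<lambda>s. mexp (s *\<^sub>R \<alpha>) *v D u (t, \<theta> + s)"])
      (use normal[OF uM] act[OF uM] \<tau>_normal twisted_curve_deriv[OF u]
        twisted_curve_deriv[OF smooth_Du, where t = t and \<theta> = \<theta> and s = 0 and \<alpha> = \<alpha>] Du_orth z in \<open>auto simp: mexp_0\<close>)
  then show ?thesis by (simp add: z mexp_0)
qed

lemma \<tau>_bound: "norm (\<tau> z) \<le> 2 * C * e z"
proof -
  have "(norm (\<tau> z))\<^sup>2 = d_t (d_t u) z \<bullet> \<tau> z + D (D u) z \<bullet> \<tau> z"
    by (simp add: power2_norm_eq_inner \<tau>_def inner_add_left)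
  also have "\<dots> \<le> 2 * C * e z * norm (\<tau> z)"
    using TTu_bound[of z] DDu_bound[of z] by (simp add: e_def power2_norm_eq_inner algebra_simps)
  finally have "norm (\<tau> z) * norm (\<tau> z) \<le> 2 * C * e z * norm (\<tau> z)" by (simp add: power2_eq_square)
  moreover have "0 \<le> 2 * C * e z" using C by (simp add: e_def)
  ultimately show ?thesis by (cases "norm (\<tau> z) = 0") auto
qed

section \<open>The Bochner inequality for the energy density\<close>

lemma T_comm: "smooth_on UNIV f \<Longrightarrow> d_t (D f) = D (d_t f)"
  by (rule d_t_d_theta_alpha_commute)

lemma T\<tau>: "d_t \<tau> z = d_t (d_t (d_t u)) z + D (D (d_t u)) z"
proof -
  have "d_t \<tau> z = d_t (d_t (d_t u)) z + d_t (D (D u)) z"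
    unfolding \<tau>_def[abs_def] by (rule d_t_add) (intro smooth_d_t smooth_D u)+
  then show ?thesis by (simp add: T_comm u smooth_Du)
qed

lemma D\<tau>: "D \<tau> z = d_t (d_t (D u)) z + D (D (D u)) z"
proof -
  have "D \<tau> z = D (d_t (d_t u)) z + D (D (D u)) z"
    unfolding \<tau>_def[abs_def] by (rule d_theta_alpha_add) (intro smooth_d_t smooth_D u)+
  then show ?thesis by (simp add: T_comm u smooth_Tu)
qed

text \<open>Differentiating <d_t u, \<tau>> = 0 trades the derivative of \<tau>, which is of third
  order in u, for a term of second order.\<close>

lemma Tu_T\<tau>: "d_t u z \<bullet> d_t \<tau> z = - (d_t (d_t u) z \<bullet> \<tau> z)"
  using has_derivative_zero_parts(1)[OF inner_twisted_has_derivative[OF smooth_Tu smooth_\<tau> skew] Tu_orth, of z]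
  by simp

lemma Du_D\<tau>: "D u z \<bullet> D \<tau> z = - (D (D u) z \<bullet> \<tau> z)"
  using has_derivative_zero_parts(2)[OF inner_twisted_has_derivative[OF smooth_Du smooth_\<tau> skew] Du_orth, of z]
  by simp

lemma e_nonneg: "e z \<ge> 0" by (simp add: e_def)

text \<open>Half the Laplacian of e is the sum of the squared second derivatives plus <d_t u, d_t
  \<tau>> + <D u, D \<tau>>, and this last sum equals -|\<tau>|^2. Dropping the squares and
  inserting |\<tau>| <= 2 C e gives the constant 8 C^2.\<close>

lemma e_C2:
  obtains ex ey exx exy eyx eyy where "C2_derivs e ex ey exx exy eyx eyy"
    "\<And>z. exx z + eyy z \<ge> - (8 * C\<^sup>2) * (e z)\<^sup>2"
proof -
  note E = C2_derivs_add[OF C2_derivs_norm_square[OF smooth_Tu skew] C2_derivs_norm_square[OF smooth_Du skew],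
      folded e_def[abs_def]]
  show thesis
  proof (rule that[OF E])
    fix z
    have 1: "d_t u z \<bullet> d_t (d_t (d_t u)) z + d_t u z \<bullet> D (D (d_t u)) z = - (d_t (d_t u) z \<bullet> \<tau> z)"
      by (simp add: Tu_T\<tau>[symmetric] T\<tau> inner_add_right)
    have 2: "D u z \<bullet> d_t (d_t (D u)) z + D u z \<bullet> D (D (D u)) z = - (D (D u) z \<bullet> \<tau> z)"
      by (simp add: Du_D\<tau>[symmetric] D\<tau> inner_add_right)
    have 3: "d_t (d_t u) z \<bullet> \<tau> z + D (D u) z \<bullet> \<tau> z = \<tau> z \<bullet> \<tau> z"
      by (simp add: \<tau>_def inner_add_left)
    have "(norm (\<tau> z))\<^sup>2 \<le> (2 * C * e z)\<^sup>2" by (intro power_mono \<tau>_bound) auto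
    then have 4: "\<tau> z \<bullet> \<tau> z \<le> 4 * C\<^sup>2 * (e z)\<^sup>2"
      by (simp add: power2_norm_eq_inner power_mult_distrib)
    have sq: "0 \<le> d_t (d_t u) z \<bullet> d_t (d_t u) z" "0 \<le> D (d_t u) z \<bullet> D (d_t u) z"
      "0 \<le> d_t (D u) z \<bullet> d_t (D u) z" "0 \<le> D (D u) z \<bullet> D (D u) z" by simp_all
    show "- (8 * C\<^sup>2) * (e z)\<^sup>2 \<le>
      (d_t u z \<bullet> d_t (d_t (d_t u)) z + d_t (d_t u) z \<bullet> d_t (d_t u) z +
        (d_t (d_t u) z \<bullet> d_t (d_t u) z + d_t (d_t (d_t u)) z \<bullet> d_t u z) +
       (D u z \<bullet> d_t (d_t (D u)) z + d_t (D u) z \<bullet> d_t (D u) z +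
        (d_t (D u) z \<bullet> d_t (D u) z + d_t (d_t (D u)) z \<bullet> D u z))) +
      (d_t u z \<bullet> D (D (d_t u)) z + D (d_t u) z \<bullet> D (d_t u) z +
        (D (d_t u) z \<bullet> D (d_t u) z + D (D (d_t u)) z \<bullet> d_t u z) +
       (D u z \<bullet> D (D (D u)) z + D (D u) z \<bullet> D (D u) z +
        (D (D u) z \<bullet> D (D u) z + D (D (D u)) z \<bullet> D u z)))"
      using 1 2 3 4 sq inner_commute[of "d_t (d_t (d_t u)) z" "d_t u z"] inner_commute[of "D (D (d_t u)) z" "d_t u z"]
        inner_commute[of "d_t (d_t (D u)) z" "D u z"] inner_commute[of "D (D (D u)) z" "D u z"]
      by linarith
  qed
qed

section \<open>Energy on unit discs and the pointwise bound\<close>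

lemma per_d_t: "(\<And>t \<theta>. f (t, \<theta> + 2*pi) = f (t, \<theta>)) \<Longrightarrow> smooth_on UNIV f \<Longrightarrow> d_t f (t, \<theta> + 2*pi) = d_t f (t, \<theta>)"
  unfolding d_t_def by (rule dderiv_periodic)

lemma per_D: "(\<And>t \<theta>. f (t, \<theta> + 2*pi) = f (t, \<theta>)) \<Longrightarrow> smooth_on UNIV f \<Longrightarrow> D f (t, \<theta> + 2*pi) = D f (t, \<theta>)"
  unfolding d_theta_alpha_def by (simp add: dderiv_periodic)

lemma per_Tu: "d_t u (t, \<theta> + 2*pi) = d_t u (t, \<theta>)" and per_Du: "D u (t, \<theta> + 2*pi) = D u (t, \<theta>)"
  using per_d_t per_D uper u by blast+

lemma per_e: "e (t, \<theta> + 2*pi) = e (t, \<theta>)"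
  unfolding e_def per_Tu per_Du ..

lemma cont_e: "continuous_on S e"
  unfolding e_def[abs_def]
  by (intro continuous_intros continuous_on_subset[OF smooth_on_continuous[OF smooth_Tu]]
      continuous_on_subset[OF smooth_on_continuous[OF smooth_Du]]) auto

text \<open>Translation by k periods preserves e and carries the basic window to the k-th one. The
  integral also changes here from the one in \<open>local_L2_DA\<close> to the nonnegative Lebesgue
  integral used in Heinz' estimate.\<close>

lemma energy_box:
  assumes E: "local_L2_DA \<alpha> u t \<le> \<epsilon>"
  shows "(\<integral>\<^sup>+z\<in>cbox (t - 1, 2 * pi * of_int k) (t + 1, 2 * pi + 2 * pi * of_int k). ennreal (e z) \<partial>lborel)
    \<le> ennreal (\<epsilon>\<^sup>2)"
proof -
  define B where "B = cbox (t - 1, 0) (t + 1, 2 * pi)"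
  define c where "c = (0 :: real, 2 * pi * of_int k)"
  have [measurable]: "e \<in> borel_measurable borel" by (intro borel_measurable_continuous_onI cont_e)
  have int: "(e has_integral integral B e) B"
    unfolding B_def by (intro integrable_integral integrable_continuous cont_e)
  have nn: "integral B e \<ge> 0" using int e_nonneg has_integral_nonneg by blast
  have "local_L2_DA \<alpha> u t = sqrt (integral B e)"
    unfolding local_L2_DA_def B_def e_def by (simp add: power2_norm_eq_inner)
  then have "integral B e \<le> \<epsilon>\<^sup>2" using E nn by (metis real_sqrt_ge_0_iff real_sqrt_le_iff real_le_rsqrt sqrt_le_D)
  moreover have "(\<integral>\<^sup>+z\<in>B. ennreal (e z) \<partial>lborel) = ennreal (integral B e)"
    using int by (intro nn_integral_has_integral_lebesgue') (auto simp: e_nonneg)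
  moreover have "(\<integral>\<^sup>+z\<in>cbox (t - 1, 2 * pi * of_int k) (t + 1, 2 * pi + 2 * pi * of_int k). ennreal (e z) \<partial>lborel)
      = (\<integral>\<^sup>+z\<in>B. ennreal (e z) \<partial>lborel)" (is "?I = _")
  proof -
    have "?I = (\<integral>\<^sup>+z\<in>cbox (t - 1, 2 * pi * of_int k) (t + 1, 2 * pi + 2 * pi * of_int k). ennreal (e z)
        \<partial>(distr lborel borel ((+) c)))"
      by (simp add: lborel_distr_plus)
    also have "\<dots> = (\<integral>\<^sup>+z. ennreal (e (c + z)) *
        indicator (cbox (t - 1, 2 * pi * of_int k) (t + 1, 2 * pi + 2 * pi * of_int k)) (c + z) \<partial>lborel)"
      by (rule nn_integral_distr) auto
    also have "\<dots> = (\<integral>\<^sup>+z\<in>B. ennreal (e z) \<partial>lborel)"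
    proof (rule nn_integral_cong)
      fix z :: "real \<times> real"
      obtain s \<theta> where z: "z = (s, \<theta>)" by fastforce
      have "e (c + z) = e z"
        using periodic_reduce[of e s \<theta> k, OF per_e] by (simp add: z c_def add.commute)
      moreover have "c + z \<in> cbox (t - 1, 2 * pi * of_int k) (t + 1, 2 * pi + 2 * pi * of_int k) \<longleftrightarrow> z \<in> B"
        by (auto simp: z c_def B_def cbox_Pair_eq)
      ultimately show "ennreal (e (c + z)) *
          indicator (cbox (t - 1, 2 * pi * of_int k) (t + 1, 2 * pi + 2 * pi * of_int k)) (c + z) =
          ennreal (e z) * indicator B z"
        by (simp add: indicator_def)
    qed
    finally show ?thesis .
  qed
  ultimately show ?thesis by (simp add: ennreal_leI)
qed

text \<open>A unit disc centred in the strip from 0 to 2 pi reaches at most into the two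
  neighbouring windows, because 1 <= 2 pi; hence the factor 3.\<close>

lemma energy_ball:
  assumes E: "\<And>t. local_L2_DA \<alpha> u t \<le> \<epsilon>" and \<theta>: "0 \<le> \<theta>" "\<theta> \<le> 2 * pi"
  shows "(\<integral>\<^sup>+z\<in>ball (t, \<theta>) 1. ennreal (e z) \<partial>lborel) \<le> ennreal (3 * \<epsilon>\<^sup>2)"
proof -
  define B where "B k = cbox (t - 1, 2 * pi * of_int k) (t + 1, 2 * pi + 2 * pi * of_int k)" for k
  have [measurable]: "e \<in> borel_measurable borel" by (intro borel_measurable_continuous_onI cont_e)
  have mB [measurable]: "B k \<in> sets borel" for k by (simp add: B_def)
  have ball: "\<exists>k\<in>{-1, 0, 1}. z \<in> B k" if "z \<in> ball (t, \<theta>) 1" for z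
  proof -
    obtain s \<phi> where z: "z = (s, \<phi>)" by fastforce
    have "\<bar>t - s\<bar> \<le> dist (t, \<theta>) z" "\<bar>\<theta> - \<phi>\<bar> \<le> dist (t, \<theta>) z"
      using dist_fst_le[of "(t, \<theta>)" z] dist_snd_le[of "(t, \<theta>)" z] by (auto simp: z dist_real_def)
    then have "\<bar>t - s\<bar> \<le> 1" "\<bar>\<theta> - \<phi>\<bar> \<le> 1" using that by auto
    then show ?thesis using \<theta> pi_ge_two by (auto simp: z B_def cbox_Pair_eq)
  qed
  have "(\<integral>\<^sup>+z\<in>ball (t, \<theta>) 1. ennreal (e z) \<partial>lborel) \<le>
      (\<integral>\<^sup>+z. ennreal (e z) * indicator (B (-1)) z + (ennreal (e z) * indicator (B 0) z + ennreal (e z) * indicator (B 1) z) \<partial>lborel)"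
  proof (rule nn_integral_mono)
    fix z
    show "ennreal (e z) * indicator (ball (t, \<theta>) 1) z \<le>
      ennreal (e z) * indicator (B (-1)) z + (ennreal (e z) * indicator (B 0) z + ennreal (e z) * indicator (B 1) z)"
      using ball[of z] by (auto simp: indicator_def add_increasing add_increasing2)
  qed
  also have "\<dots> = (\<integral>\<^sup>+z\<in>B (-1). ennreal (e z) \<partial>lborel) + ((\<integral>\<^sup>+z\<in>B 0. ennreal (e z) \<partial>lborel) + (\<integral>\<^sup>+z\<in>B 1. ennreal (e z) \<partial>lborel))"
    by (subst nn_integral_add; (subst nn_integral_add)?) auto
  also have "\<dots> \<le> ennreal (\<epsilon>\<^sup>2) + (ennreal (\<epsilon>\<^sup>2) + ennreal (\<epsilon>\<^sup>2))"
    unfolding B_def by (intro add_mono energy_box E)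
  also have "\<dots> = ennreal (3 * \<epsilon>\<^sup>2)" by (simp flip: ennreal_plus)
  finally show ?thesis .
qed

text \<open>Heinz' estimate with K = 8 C^2 and E = 3 \<epsilon>^2, so that 16 K E = 384 C^2
  \<epsilon>^2 and 4 E = 12 \<epsilon>^2.\<close>

lemma e_small:
  assumes E: "\<And>t. local_L2_DA \<alpha> u t \<le> \<epsilon>" and \<theta>: "0 \<le> \<theta>" "\<theta> \<le> 2 * pi" and \<epsilon>: "384 * C\<^sup>2 * \<epsilon>\<^sup>2 < pi"
  shows "e (t, \<theta>) \<le> 12 * \<epsilon>\<^sup>2"
proof -
  obtain ex ey exx exy eyx eyy where 1: "C2_derivs e ex ey exx exy eyx eyy"
    "\<And>z. exx z + eyy z \<ge> - (8 * C\<^sup>2) * (e z)\<^sup>2" using e_C2 by blast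
  have "e (t, \<theta>) \<le> 4 * (3 * \<epsilon>\<^sup>2)"
    by (rule heinz_estimate[OF 1(1) e_nonneg _ 1(2) energy_ball[OF E \<theta>]]) (use C \<epsilon> in auto)
  then show ?thesis by simp
qed

text \<open>Let J be the integral of |D D u|^2 over a circle. The second derivative of f is at least
  2 J - 96 C^2 \<epsilon>^2 f. The Poincare inequality gives J >= f / P and the error is at most f /
  P, so the second derivative is at least f / P.\<close>

lemma Du_vanishes:
  assumes E: "\<And>t. local_L2_DA \<alpha> u t \<le> \<epsilon>" and \<epsilon>: "384 * C\<^sup>2 * \<epsilon>\<^sup>2 < pi" "96 * C\<^sup>2 * \<epsilon>\<^sup>2 * P \<le> 1" and P: "P > 0"
    and poinc: "poincare_bound \<alpha> P"
  shows "D u z = 0"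
proof -
  define b where "b = D u"
  have b: "smooth_on UNIV b" unfolding b_def by (rule smooth_Du)
  note sm = b smooth_d_t[OF b] smooth_D[OF b] smooth_d_t[OF smooth_d_t[OF b]] smooth_D[OF smooth_D[OF b]] smooth_\<tau>
  have slice: "continuous_on S (\<lambda>\<theta>. f (t, \<theta>))" if "smooth_on UNIV f" for f :: "real \<times> real \<Rightarrow> real^'n" and S t
    by (rule continuous_on_compose2[OF smooth_on_continuous[OF that]]) (auto intro!: continuous_intros)
  note cs = sm[THEN slice]
  note cu = sm[THEN smooth_on_continuous, THEN continuous_on_subset[OF _ subset_UNIV]]
  note C2 = C2_derivs_norm_square[OF b skew]
  define g1 where "g1 z = b z \<bullet> d_t b z + d_t b z \<bullet> b z" for z
  define g2 where "g2 z = (b z \<bullet> d_t (d_t b) z + d_t b z \<bullet> d_t b z) + (d_t b z \<bullet> d_t b z + d_t (d_t b) z \<bullet> b z)" for z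
  define gy where "gy z = b z \<bullet> D b z + D b z \<bullet> b z" for z
  define gyy where "gyy z = (b z \<bullet> D (D b) z + D b z \<bullet> D b z) + (D b z \<bullet> D b z + D (D b) z \<bullet> b z)" for z
  note C2d = C2[unfolded C2_derivs_def, folded g1_def g2_def gy_def gyy_def]
  define f where "f t = integral {0..2*pi} (\<lambda>\<theta>. b (t, \<theta>) \<bullet> b (t, \<theta>))" for t
  define f1 where "f1 t = integral {0..2*pi} (\<lambda>\<theta>. g1 (t, \<theta>))" for t
  define f2 where "f2 t = integral {0..2*pi} (\<lambda>\<theta>. g2 (t, \<theta>))" for t
  have f': "(f has_real_derivative f1 t) (at t)" for t
    unfolding f_def f1_def box_real(2)[symmetric]
  proof (rule leibniz_rule_field_derivative[where U = UNIV, simplified])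
    show "((\<lambda>t. b (t, \<theta>) \<bullet> b (t, \<theta>)) has_real_derivative g1 (t, \<theta>)) (at t)" for t \<theta>
      unfolding has_real_derivative_iff_has_vector_derivative
      by (rule has_vector_derivative_fst) (use C2d in blast)
    show "continuous_on (UNIV \<times> cbox 0 (2*pi)) (\<lambda>(t, \<theta>). g1 (t, \<theta>))"
      unfolding g1_def split_def prod.collapse by (intro continuous_intros cu)
  qed (auto intro!: integrable_continuous_interval continuous_intros cs)
  have f1': "(f1 has_real_derivative f2 t) (at t)" for t
    unfolding f1_def f2_def box_real(2)[symmetric]
  proof (rule leibniz_rule_field_derivative[where U = UNIV, simplified])
    show "((\<lambda>t. g1 (t, \<theta>)) has_real_derivative g2 (t, \<theta>)) (at t)" for t \<theta>
      unfolding has_real_derivative_iff_has_vector_derivative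
      by (rule has_vector_derivative_fst) (use C2d in blast)
    show "continuous_on (UNIV \<times> cbox 0 (2*pi)) (\<lambda>(t, \<theta>). g2 (t, \<theta>))"
      unfolding g2_def split_def prod.collapse by (intro continuous_intros cu)
    show "(\<lambda>\<theta>. g1 (t, \<theta>)) integrable_on cbox 0 (2*pi)" for t
      unfolding g1_def box_real by (intro integrable_continuous_interval continuous_intros cs)
  qed
  have ineq: "f2 t \<ge> 1 / P * f t" for t
  proof -
    \<comment> \<open>The \<theta>-part of the Laplacian of |b|^2 integrates to zero over a period.
      Adding it makes the full Laplacian, and with it the equation for \<tau>, available
      pointwise.\<close>
    have "((\<lambda>\<theta>. gy (t, \<theta>)) has_vector_derivative gyy (t, \<theta>)) (at \<theta> within {0..2*pi})" for \<theta>
      by (rule has_vector_derivative_snd) (use C2d in blast)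
    then have "((\<lambda>\<theta>. gyy (t, \<theta>)) has_integral gy (t, 2*pi) - gy (t, 0)) {0..2*pi}"
      by (intro fundamental_theorem_of_calculus) auto
    moreover have "gy (t, 2*pi) = gy (t, 0)"
      using per_Du[of t 0] per_D[OF per_Du smooth_Du, of t 0] by (simp add: gy_def b_def)
    ultimately have i0: "((\<lambda>\<theta>. gyy (t, \<theta>)) has_integral 0) {0..2*pi}" by simp
    have i2: "((\<lambda>\<theta>. g2 (t, \<theta>)) has_integral f2 t) {0..2*pi}"
      unfolding f2_def g2_def by (intro integrable_integral integrable_continuous_interval continuous_intros cs)
    have ib: "((\<lambda>\<theta>. b (t, \<theta>) \<bullet> b (t, \<theta>)) has_integral f t) {0..2*pi}"
      unfolding f_def by (intro integrable_integral integrable_continuous_interval continuous_intros cs)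
    define J where "J = integral {0..2*pi} (\<lambda>\<theta>. D b (t, \<theta>) \<bullet> D b (t, \<theta>))"
    have iJ: "((\<lambda>\<theta>. D b (t, \<theta>) \<bullet> D b (t, \<theta>)) has_integral J) {0..2*pi}"
      unfolding J_def by (intro integrable_integral integrable_continuous_interval continuous_intros cs)
    have "2 * J - 96 * C\<^sup>2 * \<epsilon>\<^sup>2 * f t \<le> f2 t + 0"
    proof (rule has_integral_le[OF has_integral_diff[OF has_integral_mult_right[OF iJ] has_integral_mult_right[OF ib]]
          has_integral_add[OF i2 i0]])
      fix \<theta> assume \<theta>: "\<theta> \<in> {0..2*pi}"
      let ?z = "(t, \<theta>)"
      have 1: "b ?z \<bullet> d_t (d_t b) ?z + b ?z \<bullet> D (D b) ?z = - (D b ?z \<bullet> \<tau> ?z)"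
        using Du_D\<tau>[of ?z] D\<tau>[of ?z] by (simp add: b_def inner_add_right)
      \<comment> \<open>The constant 48 is 2 * 2 * 12, from \<open>DDu_bound\<close>,
        \<open>\<tau>_bound\<close> and the bound 12 \<epsilon>^2 on e; the Laplacian doubles it to
        96.\<close>
      have "D b ?z \<bullet> \<tau> ?z \<le> 2 * C * (norm (b ?z))\<^sup>2 * norm (\<tau> ?z)" using DDu_bound by (simp add: b_def)
      also have "\<dots> \<le> 2 * C * (norm (b ?z))\<^sup>2 * (2 * C * (12 * \<epsilon>\<^sup>2))"
        using \<tau>_bound[of ?z] e_small[OF E _ _ \<epsilon>(1), of \<theta> t] \<theta> C
        by (intro mult_left_mono order_trans[OF \<tau>_bound]) auto
      finally have "D b ?z \<bullet> \<tau> ?z \<le> 48 * C\<^sup>2 * \<epsilon>\<^sup>2 * (norm (b ?z))\<^sup>2"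
        by (simp add: power2_eq_square mult_ac)
      then have 2: "D b ?z \<bullet> \<tau> ?z \<le> 48 * C\<^sup>2 * \<epsilon>\<^sup>2 * (b ?z \<bullet> b ?z)"
        by (simp only: power2_norm_eq_inner)
      have "0 \<le> d_t b ?z \<bullet> d_t b ?z" by simp
      with 1 2 show "2 * (D b ?z \<bullet> D b ?z) - 96 * C\<^sup>2 * \<epsilon>\<^sup>2 * (b ?z \<bullet> b ?z) \<le> g2 ?z + gyy ?z"
        unfolding g2_def gyy_def
        using inner_commute[of "d_t (d_t b) ?z" "b ?z"] inner_commute[of "D (D b) ?z" "b ?z"] by linarith
    qed
    moreover have "f t \<le> P * J"
    proof -
      \<comment> \<open>Here u on the circle plays the role of g, b that of w = D g and D b that of
        v. Periodicity of u is what places b in the image of D.\<close>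
      have "integral {0..2*pi} (\<lambda>\<theta>. (norm (b (t, \<theta>)))\<^sup>2) \<le> P * integral {0..2*pi} (\<lambda>\<theta>. (norm (D b (t, \<theta>)))\<^sup>2)"
      proof (rule poinc[unfolded poincare_bound_def, rule_format, of "\<lambda>\<theta>. u (t, \<theta>)"])
        show "((\<lambda>\<theta>. u (t, \<theta>)) has_vector_derivative b (t, \<theta>) - \<alpha> *v u (t, \<theta>)) (at \<theta>)" for \<theta>
          using smooth_slice_theta[OF u] by (simp add: b_def d_theta_alpha_def)
        show "((\<lambda>\<theta>. b (t, \<theta>)) has_vector_derivative D b (t, \<theta>) - \<alpha> *v b (t, \<theta>)) (at \<theta>)" for \<theta>
          using smooth_slice_theta[OF b] by (simp add: d_theta_alpha_def)
        show "u (t, 2*pi) = u (t, 0)" using uper[of t 0] by simp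
        show "b (t, 2*pi) = b (t, 0)" using per_Du[of t 0] by (simp add: b_def)
      qed (rule cs)
      then show ?thesis by (simp add: f_def J_def power2_norm_eq_inner)
    qed
    moreover have "96 * C\<^sup>2 * \<epsilon>\<^sup>2 * f t \<le> 1 / P * f t"
    proof -
      have "f t \<ge> 0" using ib by (rule has_integral_nonneg) auto
      moreover have "96 * C\<^sup>2 * \<epsilon>\<^sup>2 \<le> 1 / P" using \<epsilon>(2) P by (simp add: pos_le_divide_eq)
      ultimately show ?thesis by (intro mult_right_mono)
    qed
    moreover have "1 / P * f t \<le> J" using \<open>f t \<le> P * J\<close> P by (simp add: pos_divide_le_eq mult.commute)
    ultimately show ?thesis by linarith
  qed
  have f0: "f t \<ge> 0" for t
    unfolding f_def by (intro integral_nonneg integrable_continuous_interval continuous_intros cs) auto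
  have fB: "f t \<le> 2 * pi * (12 * \<epsilon>\<^sup>2)" for t
  proof -
    have "f t \<le> integral {0..2*pi} (\<lambda>\<theta>. 12 * \<epsilon>\<^sup>2)"
      unfolding f_def
    proof (intro integral_le integrable_continuous_interval continuous_intros cs)
      fix \<theta> assume "\<theta> \<in> {0..2*pi}"
      then have "e (t, \<theta>) \<le> 12 * \<epsilon>\<^sup>2" using e_small[OF E _ _ \<epsilon>(1)] by auto
      then show "b (t, \<theta>) \<bullet> b (t, \<theta>) \<le> 12 * \<epsilon>\<^sup>2"
        unfolding e_def b_def using inner_ge_zero[of "d_t u (t, \<theta>)"] by linarith
    qed
    then show ?thesis by simp
  qed
  have f_zero: "f t = 0" for t
    by (rule bounded_subsolution_zero[OF f' f1' ineq _ f0 fB]) (use P in auto)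
  have zero: "b (t, \<theta>) = 0" if "\<theta> \<in> {0..2*pi}" for t \<theta>
  proof -
    have "continuous_on {0..2*pi} (\<lambda>\<theta>. b (t, \<theta>) \<bullet> b (t, \<theta>))"
      by (intro continuous_on_inner cs)
    from integral_eq_0_iff[OF this]
    have "\<forall>\<theta>\<in>{0..2*pi}. b (t, \<theta>) \<bullet> b (t, \<theta>) = 0"
      using f_zero[of t] by (simp add: f_def)
    then show ?thesis using that by simp
  qed
  obtain t \<theta> where z: "z = (t, \<theta>)" by fastforce
  \<comment> \<open>Vanishing is known for angles between 0 and 2 pi; subtracting k periods brings
    \<theta> there.\<close>
  define k where "k = \<lfloor>\<theta> / (2*pi)\<rfloor>"
  have "of_int k \<le> \<theta> / (2*pi)" "\<theta> / (2*pi) < of_int k + 1" unfolding k_def by linarith+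
  then have "\<theta> - 2 * pi * of_int k \<in> {0..2*pi}" by (auto simp: field_simps)
  from zero[OF this, of t] show ?thesis
    using periodic_reduce[of "D u" t "\<theta> - 2 * pi * of_int k" k, OF per_Du] by (simp add: z b_def)
qed

text \<open>When D u vanishes, \<tau> is just the second t-derivative of u, so its normality is the
  geodesic equation. Moreover s -> exp(s \<alpha>) u (t, \<phi> + s) is constant, and comparing s =
  0 with s = 2 pi gives the fixed point property.\<close>

lemma geodesic_of_Du_zero:
  assumes Du: "\<And>z. D u z = 0"
  shows "geodesic_in M (\<lambda>t. u (t, \<theta>))" "u z \<in> fixed_alpha \<alpha> M"
proof -
  have d: "dderiv 1 (\<lambda>t. f (t, \<theta>)) = (\<lambda>t. d_t f (t, \<theta>))" if "smooth_on UNIV f" for f :: "real \<times> real \<Rightarrow> real^'n"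
    using dderiv_vector_derivative[OF smooth_slice_t[OF that, of \<theta> _ UNIV], of 1] by (auto simp: d_t_def)
  have DDu: "D (D u) z = 0" for z
  proof -
    have "D u = (\<lambda>_. 0)" using Du by blast
    then show ?thesis using dderiv_eq[OF has_derivative_const] by (simp add: d_theta_alpha_def)
  qed
  show "geodesic_in M (\<lambda>t. u (t, \<theta>))"
    unfolding geodesic_in_def
  proof (intro conjI allI ballI)
    show "smooth_on UNIV (\<lambda>t. u (t, \<theta>))" using smooth_time_curve[OF u, of 0 \<theta>] by simp
    fix t v assume "v \<in> tangent_space M (u (t, \<theta>))"
    then show "dderiv 1 (dderiv 1 (\<lambda>t. u (t, \<theta>))) t \<bullet> v = 0"
      using \<tau>_normal by (simp add: d u smooth_Tu \<tau>_def DDu)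
  qed (rule uM)
  obtain t \<phi> where z: "z = (t, \<phi>)" by fastforce
  have "((\<lambda>s. 0) has_integral mexp ((2*pi) *\<^sub>R \<alpha>) *v u (t, \<phi> + 2*pi) - mexp (0 *\<^sub>R \<alpha>) *v u (t, \<phi> + 0)) {0..2*pi}"
    using has_vector_derivative_at_within[OF twisted_curve_deriv[OF u, where t = t and \<theta> = \<phi> and \<alpha> = \<alpha>]] Du
    by (intro fundamental_theorem_of_calculus) auto
  then have "mexp ((2*pi) *\<^sub>R \<alpha>) *v u (t, \<phi>) - u (t, \<phi>) = 0"
    using has_integral_unique[OF has_integral_0] by (fastforce simp: uper mexp_0)
  then show "u z \<in> fixed_alpha \<alpha> M" using uM by (simp add: fixed_alpha_def z)
qed

end

text \<open>Every curve in S is a curve in T. Hence an acceleration normal to M is normal to M_0,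
  and a geodesic of M lying in M_0 is a geodesic of M_0.\<close>

lemma tangent_space_mono: "S \<subseteq> T \<Longrightarrow> tangent_space S p \<subseteq> tangent_space T p"
  unfolding tangent_space_def by blast

theorem theorem4p9:
  fixes G :: "(real^'n^'n) set" and M :: "(real^'n) set" and d :: nat
  assumes "compact_connected_orthogonal_group G"
    and "compact M" and "embedded_submanifold d M"
    and "\<forall>g\<in>G. \<forall>p\<in>M. g *v p \<in> M"
  shows "\<forall>\<alpha>\<in>lie_algebra G. \<exists>\<epsilon>>0. \<forall>u :: real \<times> real \<Rightarrow> real^'n.
     smooth_on UNIV u \<and> (\<forall>z. u z \<in> M) \<and> (\<forall>t \<theta>. u (t, \<theta> + 2 * pi) = u (t, \<theta>)) \<and>
     twisted_harmonic M \<alpha> u \<and> (\<forall>t. local_L2_DA \<alpha> u t \<le> \<epsilon>)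
     \<longrightarrow> (\<forall>z. d_theta_alpha \<alpha> u z = 0) \<and>
         (\<forall>\<theta>. geodesic_in M (\<lambda>t. u (t, \<theta>))) \<and>
         (\<forall>z. u z \<in> fixed_alpha \<alpha> M) \<and>
         (fixed_alpha \<alpha> M = fixed_by_group G M \<longrightarrow>
            (\<forall>z. u z \<in> fixed_by_group G M) \<and>
            (\<forall>\<theta>. geodesic_in (fixed_by_group G M) (\<lambda>t. u (t, \<theta>))))"
proof
  fix \<alpha> assume \<alpha>: "\<alpha> \<in> lie_algebra G"
  then have inG: "mexp (s *\<^sub>R \<alpha>) \<in> G" for s unfolding lie_algebra_def by blast
  have orth: "orthogonal_matrix (mexp (s *\<^sub>R \<alpha>))" for s
    using assms(1) inG unfolding compact_connected_orthogonal_group_def by blast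
  obtain C where C: "C > 0" "\<And>p q n. \<lbrakk>p \<in> M; q \<in> M; \<forall>v\<in>tangent_space M p. n \<bullet> v = 0\<rbrakk> \<Longrightarrow>
      (q - p) \<bullet> n \<le> C * (norm (q - p))\<^sup>2 * norm n"
    using submanifold_normal_global[OF assms(3,2)] by metis
  interpret twisted_setup M \<alpha> C
    by unfold_locales (use orth inG assms(4) C in blast)+
  obtain P where P: "P > 0" "poincare_bound \<alpha> P"
    using poincare_twisted[OF orth] by blast
  \<comment> \<open>The first bound yields 384 C^2 \<epsilon>^2 <= 1 < pi for the pointwise
    estimate; the second lets the Poincare inequality absorb the error in the equation for
    f.\<close>
  define \<epsilon> where "\<epsilon> = sqrt (min (1 / (384 * C\<^sup>2)) (1 / (96 * C\<^sup>2 * P)))"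
  have \<epsilon>0: "\<epsilon> > 0" using C(1) P(1) by (simp add: \<epsilon>_def)
  have \<epsilon>2: "\<epsilon>\<^sup>2 = min (1 / (384 * C\<^sup>2)) (1 / (96 * C\<^sup>2 * P))"
    unfolding \<epsilon>_def using C(1) P(1) by (intro real_sqrt_pow2) auto
  have "384 * C\<^sup>2 * \<epsilon>\<^sup>2 \<le> 384 * C\<^sup>2 * (1 / (384 * C\<^sup>2))"
    unfolding \<epsilon>2 by (intro mult_left_mono) auto
  also have "\<dots> < pi" using C(1) pi_gt3 by simp
  finally have small1: "384 * C\<^sup>2 * \<epsilon>\<^sup>2 < pi" .
  have "96 * C\<^sup>2 * \<epsilon>\<^sup>2 * P \<le> 96 * C\<^sup>2 * (1 / (96 * C\<^sup>2 * P)) * P"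
    unfolding \<epsilon>2 using P(1) by (intro mult_left_mono mult_right_mono) auto
  also have "\<dots> = 1" using C(1) P(1) by simp
  finally have small2: "96 * C\<^sup>2 * \<epsilon>\<^sup>2 * P \<le> 1" .
  show "\<exists>\<epsilon>>0. \<forall>u :: real \<times> real \<Rightarrow> real^'n.
     smooth_on UNIV u \<and> (\<forall>z. u z \<in> M) \<and> (\<forall>t \<theta>. u (t, \<theta> + 2 * pi) = u (t, \<theta>)) \<and>
     twisted_harmonic M \<alpha> u \<and> (\<forall>t. local_L2_DA \<alpha> u t \<le> \<epsilon>)
     \<longrightarrow> (\<forall>z. d_theta_alpha \<alpha> u z = 0) \<and>
         (\<forall>\<theta>. geodesic_in M (\<lambda>t. u (t, \<theta>))) \<and>
         (\<forall>z. u z \<in> fixed_alpha \<alpha> M) \<and>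
         (fixed_alpha \<alpha> M = fixed_by_group G M \<longrightarrow>
            (\<forall>z. u z \<in> fixed_by_group G M) \<and>
            (\<forall>\<theta>. geodesic_in (fixed_by_group G M) (\<lambda>t. u (t, \<theta>))))"
  proof (intro exI[of _ \<epsilon>] conjI[OF \<epsilon>0] allI impI, goal_cases)
    case (1 u)
    then interpret twisted_map M \<alpha> C u by unfold_locales auto
    have E: "\<And>t. local_L2_DA \<alpha> u t \<le> \<epsilon>" using 1 by blast
    have Du: "D u z = 0" for z by (rule Du_vanishes[OF E small1 small2 P])
    have geo: "geodesic_in M (\<lambda>t. u (t, \<theta>))" "u z \<in> fixed_alpha \<alpha> M" for \<theta> z
      using geodesic_of_Du_zero[OF Du] by auto
    have "tangent_space (fixed_by_group G M) p \<subseteq> tangent_space M p" for p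
      by (rule tangent_space_mono) (auto simp: fixed_by_group_def)
    then have "geodesic_in (fixed_by_group G M) (\<lambda>t. u (t, \<theta>))" if "\<And>z. u z \<in> fixed_by_group G M" for \<theta>
      using geo(1)[of \<theta>] that unfolding geodesic_in_def by blast
    then show ?case using Du geo by auto
  qed
qed

end
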